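(* (i) A $2$-generator group is abelian if and only if it is an $E$-group. (ii) An infinite $3$-generator group is abelian if and only if it is an $E$-group.
   Context: A group $G$ is called an $E$-group if every element of $G$ commutes with each of its endomorphic images, i.e. $x\,x^{\alpha}=x^{\alpha}x$ for every $x\in G$ and every endomorphism $\alpha$ of $G$. An $n$-generator group is a group that can be generated by $n$ elements. *)

theory Defs
  imports "HOL-Algebra.Generated_Groups"
begin

definition E_group :: "('a, 'b) monoid_scheme \<Rightarrow> bool" where
  "E_group G \<longleftrightarrow> group G \<and>
     (\<forall>x \<in> carrier G. \<forall>\<alpha> \<in> hom G G. x \<otimes>\<^bsub>G\<^esub> \<alpha> x = \<alpha> x \<otimes>\<^bsub>G\<^esub> x)"

text \<open>The \<open>n\<close> generators need not be distinct, hence a generating set of cardinality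
  at most \<open>n\<close>: a cyclic group is also a 2-generator group.\<close>

definition generator_group :: "nat \<Rightarrow> ('a, 'b) monoid_scheme \<Rightarrow> bool" where
  "generator_group n G \<longleftrightarrow> group G \<and>
     (\<exists>S \<subseteq> carrier G. finite S \<and> card S \<le> n \<and> generate G S = carrier G)"

end

theory Submission
  imports Defs "HOL-Algebra.Multiplicative_Group" "HOL-Computational_Algebra.Primes"
begin

text \<open>Inner automorphisms show that in an \<open>E\<close>-group conjugate elements commute, so the group is
  nilpotent of class at most 2 (two generators) or 3 (three generators).

  If a nontrivial homomorphism \<open>f\<close> to the integers exists, then it may be taken surjective, and
  the endomorphisms \<open>y \<mapsto> g ^ f y\<close> force every \<open>g\<close> to commute with all \<open>x\<close> such that \<open>f x = 1\<close>;
  these generate the group. An infinite 3-generator \<open>E\<close>-group has such an \<open>f\<close>, since otherwise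
  its abelianization, and by nilpotency the group itself, would be finite.

  Let \<open>G\<close> be a finite \<open>E\<close>-group generated by \<open>a\<close> and \<open>b\<close>, with central commutator \<open>c\<close>, and let \<open>p\<close>
  be a prime dividing the order of \<open>c\<close>. If \<open>p ^ v\<close> is the \<open>p\<close>-part of the exponent \<open>n\<close> of \<open>G\<close> modulo
  \<open>c\<close>, then \<open>G\<close> has a cyclic quotient of order \<open>p ^ v\<close>, so all elements of order dividing \<open>p ^ v\<close> are
  central. Computing the \<open>n\<close>-th powers of \<open>a ^ k b ^ l\<close> modulo \<open>p\<close> yields a noncentral such element
  unless \<open>p = 2\<close> and \<open>n\<close> is twice an odd number, where \<open>G\<close> maps onto a quaternion subgroup.\<close>

section \<open>Commutators\<close>

context group
begin

lemma mult_inv_cancel: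
  assumes "x \<in> carrier G" "y \<in> carrier G"
  shows "x \<otimes> (inv x \<otimes> y) = y" "inv x \<otimes> (x \<otimes> y) = y"
  using assms by (simp_all add: m_assoc[symmetric])

definition commutator :: "'a \<Rightarrow> 'a \<Rightarrow> 'a" where
  "commutator x y = x \<otimes> y \<otimes> inv x \<otimes> inv y"

lemma commutator_closed [simp, intro]:
  "\<lbrakk>x \<in> carrier G; y \<in> carrier G\<rbrakk> \<Longrightarrow> commutator x y \<in> carrier G"
  by (simp add: commutator_def)

lemma mult_eq_commutator:
  "\<lbrakk>x \<in> carrier G; y \<in> carrier G\<rbrakk> \<Longrightarrow> x \<otimes> y = commutator x y \<otimes> (y \<otimes> x)"
  by (simp add: commutator_def m_assoc mult_inv_cancel)

lemma commutator_eq_one_iff: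
  assumes "x \<in> carrier G" "y \<in> carrier G"
  shows "commutator x y = \<one> \<longleftrightarrow> x \<otimes> y = y \<otimes> x"
proof
  assume "commutator x y = \<one>"
  then show "x \<otimes> y = y \<otimes> x" using mult_eq_commutator[OF assms] assms by simp
next
  assume "x \<otimes> y = y \<otimes> x"
  then show "commutator x y = \<one>"
    using assms by (simp add: commutator_def m_assoc mult_inv_cancel)
qed

lemma inv_commutator:
  "\<lbrakk>x \<in> carrier G; y \<in> carrier G\<rbrakk> \<Longrightarrow> inv (commutator x y) = commutator y x"
  by (simp add: commutator_def m_assoc inv_mult_group)

lemma subgroup_centralizer:
  assumes "S \<subseteq> carrier G"
  shows "subgroup {g \<in> carrier G. \<forall>s\<in>S. g \<otimes> s = s \<otimes> g} G"
proof (rule subgroupI)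
  fix g assume g: "g \<in> {g \<in> carrier G. \<forall>s\<in>S. g \<otimes> s = s \<otimes> g}"
  have "inv g \<otimes> s = s \<otimes> inv g" if "s \<in> S" for s
  proof -
    have "s \<in> carrier G" using assms that by blast
    moreover have "inv g \<otimes> (g \<otimes> s) \<otimes> inv g = inv g \<otimes> (s \<otimes> g) \<otimes> inv g"
      using g that by simp
    ultimately show ?thesis using g by (simp add: m_assoc mult_inv_cancel)
  qed
  then show "inv g \<in> {g \<in> carrier G. \<forall>s\<in>S. g \<otimes> s = s \<otimes> g}" using g by simp
next
  fix g h assume gh: "g \<in> {g \<in> carrier G. \<forall>s\<in>S. g \<otimes> s = s \<otimes> g}"
    "h \<in> {g \<in> carrier G. \<forall>s\<in>S. g \<otimes> s = s \<otimes> g}"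
  have "g \<otimes> h \<otimes> s = s \<otimes> (g \<otimes> h)" if "s \<in> S" for s
  proof -
    have s: "s \<in> carrier G" using assms that by blast
    have c: "g \<in> carrier G" "h \<in> carrier G" and gs: "g \<otimes> s = s \<otimes> g" and hs: "h \<otimes> s = s \<otimes> h"
      using gh that by auto
    have "g \<otimes> h \<otimes> s = g \<otimes> s \<otimes> h" using c s by (simp only: m_assoc hs)
    also have "\<dots> = s \<otimes> (g \<otimes> h)" using c s by (simp only: m_assoc gs)
    finally show ?thesis .
  qed
  then show "g \<otimes> h \<in> {g \<in> carrier G. \<forall>s\<in>S. g \<otimes> s = s \<otimes> g}" using gh by simp
qed (use assms in \<open>auto intro!: exI[of _ \<one>]\<close>)

text \<open>Two centralizers in turn: that of \<open>T\<close> contains \<open>S\<close>, hence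
  \<open>generate G S\<close>; that of \<open>generate G S\<close> then contains \<open>T\<close>,
  hence \<open>generate G T\<close>.\<close>

lemma generate_commute:
  assumes S: "S \<subseteq> carrier G" and T: "T \<subseteq> carrier G"
    and comm: "\<And>s t. \<lbrakk>s \<in> S; t \<in> T\<rbrakk> \<Longrightarrow> s \<otimes> t = t \<otimes> s"
    and x: "x \<in> generate G S" and y: "y \<in> generate G T"
  shows "x \<otimes> y = y \<otimes> x"
proof -
  have x1: "generate G S \<subseteq> {g \<in> carrier G. \<forall>t\<in>T. g \<otimes> t = t \<otimes> g}"
    using S comm by (intro generate_subgroup_incl subgroup_centralizer T) auto
  have "T \<subseteq> {g \<in> carrier G. \<forall>s\<in>generate G S. g \<otimes> s = s \<otimes> g}"
    using x1 T by auto
  then have "generate G T \<subseteq> {g \<in> carrier G. \<forall>s\<in>generate G S. g \<otimes> s = s \<otimes> g}"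
    by (intro generate_subgroup_incl subgroup_centralizer generate_incl S)
  then show ?thesis using x y by auto
qed

lemma int_pow_commute:
  assumes "x \<in> carrier G" "y \<in> carrier G" "x \<otimes> y = y \<otimes> x"
  shows "x [^] (i::int) \<otimes> y [^] (j::int) = y [^] j \<otimes> x [^] i"
  by (rule generate_commute[of "{x}" "{y}"]) (use assms in \<open>auto simp: generate_pow\<close>)

lemma int_pow_conj:
  assumes "g \<in> carrier G" "x \<in> carrier G"
  shows "(g \<otimes> x \<otimes> inv g) [^] (i::int) = g \<otimes> x [^] i \<otimes> inv g"
proof -
  have "(\<lambda>x. g \<otimes> x \<otimes> inv g) \<in> hom G G"
    using assms by (auto simp: hom_def m_assoc mult_inv_cancel)
  from hom_int_pow[OF this assms(2)] show ?thesis
    by (simp add: is_group)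
qed

text \<open>Since x = w (y x y^-1) with commuting factors, powers of x can be taken factor by
  factor; this settles l = 1. The exponent of y follows from the same argument with the roles
  exchanged.\<close>

lemma class_two_int_pow_mult:
  assumes xyw: "x \<in> carrier G" "y \<in> carrier G" "w \<in> carrier G"
    and wx: "w \<otimes> x = x \<otimes> w" and wy: "w \<otimes> y = y \<otimes> w"
    and eq: "x \<otimes> y = w \<otimes> (y \<otimes> x)"
  shows "x [^] (k::int) \<otimes> y [^] (l::int) = w [^] (k * l) \<otimes> (y [^] l \<otimes> x [^] k)"
proof -
  have one: "x [^] k \<otimes> y = w [^] k \<otimes> (y \<otimes> x [^] k)"
    if xyw: "x \<in> carrier G" "y \<in> carrier G" "w \<in> carrier G"
    and wx: "w \<otimes> x = x \<otimes> w" and wy: "w \<otimes> y = y \<otimes> w"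
    and eq: "x \<otimes> y = w \<otimes> (y \<otimes> x)" for x y w and k :: int
  proof -
    have x: "x = w \<otimes> (y \<otimes> x \<otimes> inv y)"
    proof -
      have "x = x \<otimes> y \<otimes> inv y" using xyw by (simp add: m_assoc)
      also have "\<dots> = w \<otimes> (y \<otimes> x \<otimes> inv y)" unfolding eq using xyw by (simp add: m_assoc)
      finally show ?thesis .
    qed
    have c: "w \<otimes> (y \<otimes> x \<otimes> inv y) = (y \<otimes> x \<otimes> inv y) \<otimes> w"
      by (rule generate_commute[of "{w}" "{x,y}"])
        (use xyw wx wy in \<open>auto intro: generate.eng[OF generate.eng] generate.incl generate.inv\<close>)
    have "x [^] k = (w \<otimes> (y \<otimes> x \<otimes> inv y)) [^] k"
      by (rule arg_cong[OF x])
    also have "\<dots> = w [^] k \<otimes> (y \<otimes> x \<otimes> inv y) [^] k"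
      using xyw by (intro int_pow_mult_distrib c) auto
    also have "\<dots> = w [^] k \<otimes> (y \<otimes> x [^] k \<otimes> inv y)"
      using xyw by (simp add: int_pow_conj)
    finally have "x [^] k \<otimes> y = w [^] k \<otimes> (y \<otimes> x [^] k \<otimes> inv y) \<otimes> y" by simp
    then show ?thesis using xyw by (simp add: m_assoc)
  qed
  define w' where "w' = w [^] k"
  define x' where "x' = x [^] k"
  have c: "w' \<in> carrier G" "x' \<in> carrier G" using xyw by (simp_all add: w'_def x'_def)
  have w'x': "w' \<otimes> x' = x' \<otimes> w'"
    unfolding w'_def x'_def by (rule int_pow_commute) (use xyw wx in auto)
  have w'y: "w' \<otimes> y = y \<otimes> w'"
    using int_pow_commute[of w y k 1] xyw wy by (simp add: w'_def)
  have "x' \<otimes> y = w' \<otimes> (y \<otimes> x')" unfolding x'_def w'_def by (rule one) (use assms in auto)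
  \<comment> \<open>With y moved to the front, \<open>one\<close> applies to y, x^k and
    w^-k.\<close>
  then have "y \<otimes> x' = inv w' \<otimes> (x' \<otimes> y)"
    using c xyw by (simp add: mult_inv_cancel)
  moreover have "inv w' \<otimes> x' = x' \<otimes> inv w'" "inv w' \<otimes> y = y \<otimes> inv w'"
    using int_pow_commute[of w' x' "-1" 1] int_pow_commute[of w' y "-1" 1] c xyw w'x' w'y
    by (simp_all add: int_pow_neg)
  ultimately have "y [^] l \<otimes> x' = (inv w') [^] l \<otimes> (x' \<otimes> y [^] l)"
    by (intro one) (use c xyw in auto)
  then have "x' \<otimes> y [^] l = w' [^] l \<otimes> (y [^] l \<otimes> x')"
    using c xyw by (simp add: mult_inv_cancel int_pow_inv)
  then show ?thesis using xyw by (simp add: x'_def w'_def int_pow_pow)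
qed

lemma commutator_int_pow_left:
  assumes xy: "x \<in> carrier G" "y \<in> carrier G"
    and "commutator x y \<otimes> x = x \<otimes> commutator x y"
    and "commutator x y \<otimes> y = y \<otimes> commutator x y"
  shows "commutator (x [^] (k::int)) y = commutator x y [^] k"
proof -
  have "x [^] k \<otimes> y [^] (1::int) = commutator x y [^] (k * 1) \<otimes> (y [^] (1::int) \<otimes> x [^] k)"
    by (rule class_two_int_pow_mult) (use assms mult_eq_commutator[OF xy] in simp_all)
  then show ?thesis
    using xy by (simp add: commutator_def m_assoc mult_inv_cancel)
qed

text \<open>Writing [x,y] for \<open>commutator x y\<close>, closure rests on [g^-1,y] = g^-1
  [g,y]^-1 g and [gh,y] = g [h,y] g^-1 [g,y].\<close>

lemma subgroup_commutator_in_normal: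
  assumes N: "N \<lhd> G" and y: "y \<in> carrier G"
  shows "subgroup {x \<in> carrier G. commutator x y \<in> N} G"
proof -
  interpret N: normal N G by (rule N)
  show ?thesis
  proof (rule subgroupI)
    show "{x \<in> carrier G. commutator x y \<in> N} \<noteq> {}"
      using y by (auto intro!: exI[of _ \<one>] simp: commutator_def)
  next
    fix g assume g: "g \<in> {x \<in> carrier G. commutator x y \<in> N}"
    have "inv g \<otimes> inv (commutator g y) \<otimes> inv (inv g) \<in> N"
      using g by (intro N.inv_op_closed2) auto
    also have "inv g \<otimes> inv (commutator g y) \<otimes> inv (inv g) = commutator (inv g) y"
      using g y by (simp add: commutator_def m_assoc mult_inv_cancel inv_mult_group)
    finally show "inv g \<in> {x \<in> carrier G. commutator x y \<in> N}" using g by simp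
  next
    fix g h assume gh: "g \<in> {x \<in> carrier G. commutator x y \<in> N}"
      "h \<in> {x \<in> carrier G. commutator x y \<in> N}"
    have "g \<otimes> commutator h y \<otimes> inv g \<otimes> commutator g y \<in> N"
      using gh by (intro N.m_closed N.inv_op_closed2) auto
    also have "g \<otimes> commutator h y \<otimes> inv g \<otimes> commutator g y = commutator (g \<otimes> h) y"
      using gh y by (simp add: commutator_def m_assoc mult_inv_cancel inv_mult_group)
    finally show "g \<otimes> h \<in> {x \<in> carrier G. commutator x y \<in> N}" using gh by simp
  qed auto
qed

lemma commutator_in_normal_swap:
  assumes "N \<lhd> G" "x \<in> carrier G" "y \<in> carrier G" "commutator x y \<in> N"
  shows "commutator y x \<in> N"
proof -
  interpret N: normal N G by fact
  show ?thesis using N.m_inv_closed[OF assms(4)] assms by (simp add: inv_commutator)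
qed

text \<open>The analogue of \<open>generate_commute\<close> modulo \<open>N\<close>: the subgroups
  of all x with [x,y] in \<open>N\<close> replace the centralizers.\<close>

lemma generate_commutator_in_normal:
  assumes N: "N \<lhd> G" and S: "S \<subseteq> carrier G" and T: "T \<subseteq> carrier G"
    and comm: "\<And>s t. \<lbrakk>s \<in> S; t \<in> T\<rbrakk> \<Longrightarrow> commutator s t \<in> N"
    and x: "x \<in> generate G S" and y: "y \<in> generate G T"
  shows "commutator x y \<in> N"
proof -
  have *: "commutator z t \<in> N" if "z \<in> generate G S" "t \<in> T" for z t
  proof -
    have "generate G S \<subseteq> {x \<in> carrier G. commutator x t \<in> N}"
      using S T comm that
      by (intro generate_subgroup_incl subgroup_commutator_in_normal[OF N]) auto
    then show ?thesis using that by blast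
  qed
  have xc: "x \<in> carrier G" using generate_in_carrier[OF S x] .
  have "generate G T \<subseteq> {y \<in> carrier G. commutator y x \<in> N}"
    using T xc *[OF x] commutator_in_normal_swap[OF N xc]
    by (intro generate_subgroup_incl subgroup_commutator_in_normal[OF N]) auto
  then have "commutator y x \<in> N" using y by blast
  then show ?thesis
    using commutator_in_normal_swap[OF N generate_in_carrier[OF T y] xc] by blast
qed

text \<open>Negative powers are included in \<open>norm\<close> because for infinite K the inclusion
  of x K x^-1 in K does not in general give that of x^-1 K x.\<close>

lemma subgroup_mult_int_pow:
  assumes K: "subgroup K G" and x: "x \<in> carrier G"
    and norm: "\<And>k i. k \<in> K \<Longrightarrow> x [^] (i::int) \<otimes> k \<otimes> inv (x [^] i) \<in> K"
  shows "subgroup {k \<otimes> x [^] (i::int) | k i. k \<in> K} G"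
proof -
  interpret K: subgroup K G by (rule K)
  show ?thesis
  proof (rule subgroupI)
    show "{k \<otimes> x [^] (i::int) | k i. k \<in> K} \<noteq> {}" using K.one_closed by blast
    show "{k \<otimes> x [^] (i::int) | k i. k \<in> K} \<subseteq> carrier G" using x by auto
  next
    fix g assume "g \<in> {k \<otimes> x [^] (i::int) | k i. k \<in> K}"
    then obtain k i where g: "g = k \<otimes> x [^] (i::int)" "k \<in> K" by blast
    have "inv g = (x [^] (-i) \<otimes> inv k \<otimes> inv (x [^] (-i))) \<otimes> x [^] (-i)"
      using g x by (simp add: inv_mult_group int_pow_neg m_assoc)
    then show "inv g \<in> {k \<otimes> x [^] (i::int) | k i. k \<in> K}"
      using norm[of "inv k" "-i"] g by blast
  next
    fix g h assume "g \<in> {k \<otimes> x [^] (i::int) | k i. k \<in> K}"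
      "h \<in> {k \<otimes> x [^] (i::int) | k i. k \<in> K}"
    then obtain k i l j where g: "g = k \<otimes> x [^] (i::int)" "k \<in> K"
      and h: "h = l \<otimes> x [^] (j::int)" "l \<in> K" by blast
    have "g \<otimes> h = (k \<otimes> (x [^] i \<otimes> l \<otimes> inv (x [^] i))) \<otimes> x [^] (i + j)"
      using g h x by (simp add: int_pow_mult m_assoc mult_inv_cancel)
    then show "g \<otimes> h \<in> {k \<otimes> x [^] (i::int) | k i. k \<in> K}"
      using norm[of l i] g h K.m_closed by blast
  qed
qed

text \<open>Divide the exponent by m with remainder: the multiple of m is absorbed into K, and only
  finitely many remainders are left.\<close>

lemma finite_mult_int_pow:
  assumes K: "subgroup K G" "finite K" and x: "x \<in> carrier G"
    and m: "m > 0" "x [^] (m::int) \<in> K"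
  shows "finite {k \<otimes> x [^] (i::int) | k i. k \<in> K}"
proof -
  interpret K: subgroup K G by (rule K)
  have "{k \<otimes> x [^] (i::int) | k i. k \<in> K} \<subseteq> (\<lambda>(k, i). k \<otimes> x [^] i) ` (K \<times> {0..<m})"
  proof
    fix g assume "g \<in> {k \<otimes> x [^] (i::int) | k i. k \<in> K}"
    then obtain k i where g: "g = k \<otimes> x [^] (i::int)" "k \<in> K" by blast
    have "x [^] i = x [^] (m * (i div m) + i mod m)" by simp
    also have "\<dots> = (x [^] m) [^] (i div m) \<otimes> x [^] (i mod m)"
      using x by (simp only: int_pow_mult int_pow_pow)
    finally have "g = (k \<otimes> (x [^] m) [^] (i div m)) \<otimes> x [^] (i mod m)"
      using g x by (simp add: m_assoc)
    moreover have "k \<otimes> (x [^] m) [^] (i div m) \<in> K"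
      using g m subgroup_int_pow_closed[OF K(1)] by blast
    ultimately show "g \<in> (\<lambda>(k, i). k \<otimes> x [^] i) ` (K \<times> {0..<m})"
      using m by (intro image_eqI[of _ _ "(k \<otimes> (x [^] m) [^] (i div m), i mod m)"]) auto
  qed
  then show ?thesis by (rule finite_subset) (use K(2) in auto)
qed

lemma generate_insert_subset:
  assumes S: "S \<subseteq> carrier G" and x: "x \<in> carrier G"
    and norm: "\<And>k i. k \<in> generate G S \<Longrightarrow> x [^] (i::int) \<otimes> k \<otimes> inv (x [^] i) \<in> generate G S"
  shows "generate G (insert x S) \<subseteq> {k \<otimes> x [^] (i::int) | k i. k \<in> generate G S}"
proof (rule generate_subgroup_incl)
  have "x = \<one> \<otimes> x [^] (1::int)" using x by simp
  moreover have "s = s \<otimes> x [^] (0::int)" if "s \<in> S" for s using S that by auto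
  ultimately show "insert x S \<subseteq> {k \<otimes> x [^] (i::int) | k i. k \<in> generate G S}"
    using generate.one[of G S] generate.incl[of _ S G] by blast
qed (intro subgroup_mult_int_pow generate_is_subgroup assms)

lemma generate_commuting_int_pow_eq_one:
  assumes S: "S \<subseteq> carrier G" and comm: "\<And>x y. \<lbrakk>x \<in> S; y \<in> S\<rbrakk> \<Longrightarrow> x \<otimes> y = y \<otimes> x"
    and pow: "\<And>x. x \<in> S \<Longrightarrow> x [^] (n::int) = \<one>" and x: "x \<in> generate G S"
  shows "x [^] n = \<one>"
  using x
proof (induction rule: generate.induct)
  case (inv h)
  then show ?case using S pow by (auto simp: int_pow_inv)
next
  case (eng g h)
  then show ?case
    using generate_commute[OF S S comm, of g h] generate_in_carrier[OF S]
    by (simp add: int_pow_mult_distrib)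
qed (use pow in auto)

lemma finite_generate_commuting:
  assumes "finite S" "S \<subseteq> carrier G"
    and "\<And>x y. \<lbrakk>x \<in> S; y \<in> S\<rbrakk> \<Longrightarrow> x \<otimes> y = y \<otimes> x"
    and "\<And>x. x \<in> S \<Longrightarrow> x [^] (m::int) = \<one>" and m: "m > 0"
  shows "finite (generate G S)"
  using assms(1-4)
proof (induction S)
  case empty
  then show ?case by (simp add: generate_empty)
next
  case (insert x S)
  have S: "S \<subseteq> carrier G" and x: "x \<in> carrier G" using insert by auto
  have fin: "finite (generate G S)" using insert by (intro insert.IH) auto
  have "x [^] (i::int) \<otimes> k \<otimes> inv (x [^] i) = k" if k: "k \<in> generate G S" for k i
  proof -
    have "x [^] i \<otimes> k = k \<otimes> x [^] i"
    proof (rule generate_commute[of "{x}" S])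
      show "x [^] i \<in> generate G {x}" using x by (auto simp: generate_pow)
    qed (use insert k in auto)
    then show ?thesis using generate_in_carrier[OF S k] x by (simp add: m_assoc)
  qed
  then have "generate G (insert x S) \<subseteq> {k \<otimes> x [^] (i::int) | k i. k \<in> generate G S}"
    by (intro generate_insert_subset S x) auto
  moreover have "finite {k \<otimes> x [^] (i::int) | k i. k \<in> generate G S}"
    using insert.prems m generate.one[of G S]
    by (intro finite_mult_int_pow[of _ _ m] generate_is_subgroup S x fin) auto
  ultimately show ?case by (rule finite_subset)
qed

end

text \<open>Such a set is a subgroup of the integers, so its least positive element divides all
  others.\<close>

lemma int_set_diff_closed_dvd:
  fixes S :: "int set"
  assumes diff: "\<And>x y. \<lbrakk>x \<in> S; y \<in> S\<rbrakk> \<Longrightarrow> x - y \<in> S" and s: "s \<in> S" "s \<noteq> 0"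
  obtains d where "d > 0" "d \<in> S" "\<And>x. x \<in> S \<Longrightarrow> d dvd x"
proof -
  have zero: "0 \<in> S" using diff[OF s(1) s(1)] by simp
  have neg: "- x \<in> S" if "x \<in> S" for x using diff[OF zero that] by simp
  have add: "x + y \<in> S" if "x \<in> S" "y \<in> S" for x y using diff[OF that(1) neg[OF that(2)]] by simp
  have mult_nat: "int n * x \<in> S" if "x \<in> S" for n x
    by (induction n) (use zero add that in \<open>auto simp: distrib_right\<close>)
  have mult: "q * x \<in> S" if "x \<in> S" for q x
    by (cases q rule: int_cases2) (use mult_nat[OF that] neg in auto)
  define m where "m = (LEAST n. n > 0 \<and> int n \<in> S)"
  have "\<bar>s\<bar> \<in> S" using s(1) neg[OF s(1)] by (simp add: abs_if)
  then have "nat \<bar>s\<bar> > 0 \<and> int (nat \<bar>s\<bar>) \<in> S" using s(2) by simp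
  then have m: "m > 0 \<and> int m \<in> S" unfolding m_def by (rule LeastI)
  have "int m dvd x" if x: "x \<in> S" for x
  proof (rule ccontr)
    assume "\<not> int m dvd x"
    then have pos: "x mod int m > 0"
      using m by (metis dvd_eq_mod_eq_0 of_nat_0_less_iff order_less_le pos_mod_sign)
    have "x - (x div int m) * int m \<in> S"
      using m by (intro diff[OF x] mult) blast
    then have "x mod int m \<in> S" by (simp only: minus_div_mult_eq_mod)
    with pos have "nat (x mod int m) > 0 \<and> int (nat (x mod int m)) \<in> S" by simp
    then have "m \<le> nat (x mod int m)"
      unfolding m_def by (rule Least_le)
    moreover have "x mod int m < int m" using m by simp
    ultimately show False using pos by linarith
  qed
  then show thesis using that[of "int m"] m by (metis of_nat_0_less_iff)
qed

section \<open>Homomorphisms to the integers\<close>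

text \<open>\<open>P T\<close> says that one nonzero n sends all n-th powers into the subgroup
  generated by T. It holds for \<open>S\<close> and fails for the empty set, so it starts to hold
  when some x joins some T. Modulo K, generated by that T, the element x has infinite order, so the
  exponent of x in y^n = k x^i depends only on y, and it is additive in y.\<close>

lemma (in comm_group) unbounded_exponent_imp_hom_int:
  assumes S: "finite S" "S \<subseteq> carrier G" "generate G S = carrier G"
    and unb: "\<nexists>n::int. n \<noteq> 0 \<and> (\<forall>y\<in>carrier G. y [^] n = \<one>)"
  obtains f :: "'a \<Rightarrow> int" and x
  where "\<And>y z. \<lbrakk>y \<in> carrier G; z \<in> carrier G\<rbrakk> \<Longrightarrow> f (y \<otimes> z) = f y + f z"
    and "x \<in> carrier G" "f x \<noteq> 0"
proof -
  define P where "P T \<longleftrightarrow> (\<exists>n::int. n \<noteq> 0 \<and> (\<forall>y\<in>carrier G. y [^] n \<in> generate G T))" for T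
  have "\<exists>T x. T \<subseteq> carrier G \<and> x \<in> carrier G \<and> \<not> P T \<and> P (insert x T)"
    if "finite T" "T \<subseteq> carrier G" "P T" for T
    using that
  proof (induction T)
    case empty
    then show ?case using unb by (simp add: P_def generate_empty)
  qed auto
  from this[OF S(1,2)] obtain T x where T: "T \<subseteq> carrier G" and x: "x \<in> carrier G"
    and nP: "\<not> P T" and P: "P (insert x T)"
    unfolding P_def S(3) by (metis int_pow_closed zero_neq_one)
  define K where "K = generate G T"
  interpret K: subgroup K G unfolding K_def by (rule generate_is_subgroup[OF T])
  obtain n :: int where n: "n \<noteq> 0" "\<And>y. y \<in> carrier G \<Longrightarrow> y [^] n \<in> generate G (insert x T)"
    using P unfolding P_def by blast
  have "generate G (insert x T) \<subseteq> {k \<otimes> x [^] (i::int) | k i. k \<in> generate G T}"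
  proof (rule generate_insert_subset[OF T x])
    fix k and i :: int assume k: "k \<in> generate G T"
    then have "k \<in> carrier G" using generate_in_carrier T by blast
    then have "x [^] i \<otimes> k \<otimes> inv (x [^] i) = k"
      using x by (simp add: m_comm[of "x [^] i" k] m_assoc)
    then show "x [^] i \<otimes> k \<otimes> inv (x [^] i) \<in> generate G T" using k by simp
  qed
  then have ex: "\<exists>k i. y [^] n = k \<otimes> x [^] (i::int) \<and> k \<in> K" if "y \<in> carrier G" for y
    using n(2)[OF that] unfolding K_def by blast
  \<comment> \<open>Otherwise all (n m)-th powers would lie in K, contrary to the choice of
    T.\<close>
  have xK: "m = 0" if m: "x [^] (m::int) \<in> K" for m
  proof (rule ccontr)
    assume m0: "m \<noteq> 0"
    have "y [^] (n * m) \<in> K" if y: "y \<in> carrier G" for y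
    proof -
      obtain k i where k: "y [^] n = k \<otimes> x [^] (i::int)" "k \<in> K" using ex[OF y] by blast
      have "y [^] (n * m) = (k \<otimes> x [^] i) [^] m" using y by (simp add: int_pow_pow flip: k(1))
      also have "\<dots> = k [^] m \<otimes> (x [^] m) [^] i"
        using k x by (simp add: int_pow_distrib int_pow_pow mult.commute)
      also have "\<dots> \<in> K"
        using k m subgroup_int_pow_closed[OF K.subgroup_axioms] by auto
      finally show ?thesis .
    qed
    then have "P T" unfolding P_def K_def[symmetric] using n m0 by (intro exI[of _ "n * m"]) auto
    then show False using nP by blast
  qed
  define f where "f y = (SOME i. \<exists>k\<in>K. y [^] n = k \<otimes> x [^] (i::int))" for y
  have f: "\<exists>k\<in>K. y [^] n = k \<otimes> x [^] f y" if "y \<in> carrier G" for y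
    unfolding f_def by (rule someI_ex) (use ex[OF that] in blast)
  have f_eq: "f y = i" if y: "y \<in> carrier G" and k: "k \<in> K" "y [^] n = k \<otimes> x [^] i" for y i k
  proof -
    obtain l where l: "l \<in> K" "y [^] n = l \<otimes> x [^] f y" using f[OF y] by blast
    have "x [^] (f y - i) = inv l \<otimes> (l \<otimes> x [^] f y) \<otimes> inv (x [^] i)"
      using l x by (simp add: int_pow_diff m_assoc mult_inv_cancel)
    also have "\<dots> = inv l \<otimes> (k \<otimes> x [^] i) \<otimes> inv (x [^] i)"
      by (simp only: l(2)[symmetric] k(2)[symmetric])
    also have "\<dots> = inv l \<otimes> k" using l(1) k(1) x by (simp add: m_assoc)
    finally have "x [^] (f y - i) \<in> K" using l k by simp
    then show ?thesis using xK by fastforce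
  qed
  show thesis
  proof
    fix y z assume yz: "y \<in> carrier G" "z \<in> carrier G"
    obtain k l where k: "k \<in> K" "y [^] n = k \<otimes> x [^] f y" and l: "l \<in> K" "z [^] n = l \<otimes> x [^] f z"
      using f yz by blast
    have "(y \<otimes> z) [^] n = (k \<otimes> l) \<otimes> x [^] (f y + f z)"
      using yz k l x by (simp add: int_pow_distrib int_pow_mult m_ac)
    then show "f (y \<otimes> z) = f y + f z" using yz k l by (intro f_eq) auto
  next
    have "f x = n" by (rule f_eq[of _ \<one>]) (use x in auto)
    then show "f x \<noteq> 0" using n by simp
  qed (rule x)
qed

lemma E_group_hom_int_imp_comm_group:
  fixes G (structure) and f :: "'a \<Rightarrow> int"
  assumes E: "E_group G"
    and f: "\<And>y z. \<lbrakk>y \<in> carrier G; z \<in> carrier G\<rbrakk> \<Longrightarrow> f (y \<otimes> z) = f y + f z"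
    and x: "x \<in> carrier G" "f x \<noteq> 0"
  shows "comm_group G"
proof -
  interpret group G using E by (simp add: E_group_def)
  have "f \<one> = 0" using f[of \<one> \<one>] by simp
  then have f_inv: "f (inv y) = - f y" if "y \<in> carrier G" for y
    using f[of "inv y" y] that by simp
  \<comment> \<open>The image of f is a subgroup of the integers; dividing f by its positive
    generator d makes it surjective.\<close>
  have "u - v \<in> f ` carrier G" if "u \<in> f ` carrier G" "v \<in> f ` carrier G" for u v
  proof -
    obtain y z where "y \<in> carrier G" "u = f y" "z \<in> carrier G" "v = f z" using \<open>u \<in> _\<close> \<open>v \<in> _\<close> by blast
    then show ?thesis by (intro image_eqI[of _ _ "y \<otimes> inv z"]) (simp_all add: f f_inv)
  qed
  then obtain d where d: "d > 0" "d \<in> f ` carrier G" "\<And>u. u \<in> f ` carrier G \<Longrightarrow> d dvd u"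
    using int_set_diff_closed_dvd[of "f ` carrier G" "f x"] x by blast
  then obtain t where t: "t \<in> carrier G" "f t = d" by blast
  have hom: "(\<lambda>y. g [^] (f y div d)) \<in> hom G G" if g: "g \<in> carrier G" for g
  proof -
    have "f (y \<otimes> z) div d = f y div d + f z div d" if "y \<in> carrier G" "z \<in> carrier G" for y z
      using that d(3) by (simp add: f div_plus_div_distrib_dvd_left)
    then show ?thesis using g by (auto simp: hom_def int_pow_mult)
  qed
  have one: "y \<otimes> g = g \<otimes> y" if "y \<in> carrier G" "f y = d" "g \<in> carrier G" for y g
    using E hom[OF that(3)] that d(1) by (auto simp: E_group_def dest!: bspec[of _ _ y])
  have "y \<otimes> g = g \<otimes> y" if y: "y \<in> carrier G" and g: "g \<in> carrier G" for y g
  proof -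
    \<comment> \<open>Both s and t take the value d, and y is s times a power of t, so commuting
      with the elements of value d is enough.\<close>
    define s where "s = y \<otimes> t [^] (1 - f y div d)"
    have f_pow: "f (t [^] (i::int)) = i * d" for i
    proof -
      have nat: "f (t [^] (n::nat)) = int n * d" for n
        by (induction n) (use t \<open>f \<one> = 0\<close> in \<open>auto simp: f algebra_simps\<close>)
      then show ?thesis
        by (cases i rule: int_cases2) (use t in \<open>auto simp: int_pow_int int_pow_neg f_inv\<close>)
    qed
    have "f s = d" using y t d by (simp add: s_def f f_pow algebra_simps)
    then have "g \<otimes> s = s \<otimes> g" using one[of s g] g y t by (simp add: s_def)
    moreover have "g \<otimes> t = t \<otimes> g" using one t g by simp
    ultimately have c: "{s, t} \<subseteq> {h \<in> carrier G. \<forall>z\<in>{g}. h \<otimes> z = z \<otimes> h}"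
      using t y by (auto simp: s_def)
    have sub: "subgroup {h \<in> carrier G. \<forall>z\<in>{g}. h \<otimes> z = z \<otimes> h} G"
      by (rule subgroup_centralizer) (use g in auto)
    have "s \<otimes> inv (t [^] (1 - f y div d)) \<in> {h \<in> carrier G. \<forall>z\<in>{g}. h \<otimes> z = z \<otimes> h}"
      by (intro subgroup.m_closed[OF sub] subgroup.m_inv_closed[OF sub] subgroup_int_pow_closed[OF sub])
        (use c in auto)
    then show ?thesis using y t by (simp add: s_def m_assoc)
  qed
  then show ?thesis by (intro group.group_comm_groupI is_group)
qed

section \<open>Groups in which conjugate elements commute\<close>

text \<open>An element commutes with g x g^-1 and x alike only through [g,x]: x commutes with g x
  g^-1 exactly when it commutes with [g,x], so this is the 2-Engel law.\<close>

locale two_engel_group = group +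
  assumes commute_conj:
    "\<lbrakk>x \<in> carrier G; g \<in> carrier G\<rbrakk> \<Longrightarrow> x \<otimes> (g \<otimes> x \<otimes> inv g) = (g \<otimes> x \<otimes> inv g) \<otimes> x"

lemma E_group_imp_two_engel_group:
  assumes "E_group G"
  shows "two_engel_group G"
proof -
  interpret group G using assms by (simp add: E_group_def)
  have "(\<lambda>x. g \<otimes>\<^bsub>G\<^esub> x \<otimes>\<^bsub>G\<^esub> inv\<^bsub>G\<^esub> g) \<in> hom G G" if "g \<in> carrier G" for g
    using that by (auto simp: hom_def m_assoc mult_inv_cancel)
  then show ?thesis
    using assms unfolding E_group_def by unfold_locales (blast dest: bspec)
qed

context two_engel_group
begin

definition normal_closure :: "'a \<Rightarrow> 'a set" where
  "normal_closure x = generate G {g \<otimes> x \<otimes> inv g | g. g \<in> carrier G}"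

lemma normal_closure:
  assumes x: "x \<in> carrier G"
  shows "normal_closure x \<lhd> G" "x \<in> normal_closure x"
proof -
  show "normal_closure x \<lhd> G"
    unfolding normal_closure_def
  proof (rule normal_generateI)
    fix h k assume "h \<in> {g \<otimes> x \<otimes> inv g | g. g \<in> carrier G}" and k: "k \<in> carrier G"
    then obtain g where g: "g \<in> carrier G" "h = g \<otimes> x \<otimes> inv g" by blast
    then have "k \<otimes> h \<otimes> inv k = (k \<otimes> g) \<otimes> x \<otimes> inv (k \<otimes> g)"
      using x k by (simp add: m_assoc inv_mult_group)
    then show "k \<otimes> h \<otimes> inv k \<in> {g \<otimes> x \<otimes> inv g | g. g \<in> carrier G}"
      using g k by blast
  qed (use x in auto)
  have "x = \<one> \<otimes> x \<otimes> inv \<one>" using x by simp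
  then show "x \<in> normal_closure x" unfolding normal_closure_def
    by (intro generate.incl) blast
qed

text \<open>Conjugation by g reduces a pair of conjugates of x, by g and by h, to x itself and its
  conjugate by g^-1 h.\<close>

lemma normal_closure_commute:
  assumes x: "x \<in> carrier G" and "y \<in> normal_closure x" "z \<in> normal_closure x"
  shows "y \<otimes> z = z \<otimes> y"
proof (rule generate_commute)
  show "y \<in> generate G {g \<otimes> x \<otimes> inv g | g. g \<in> carrier G}"
    "z \<in> generate G {g \<otimes> x \<otimes> inv g | g. g \<in> carrier G}"
    using assms by (simp_all add: normal_closure_def)
  fix s t assume "s \<in> {g \<otimes> x \<otimes> inv g | g. g \<in> carrier G}" "t \<in> {g \<otimes> x \<otimes> inv g | g. g \<in> carrier G}"
  then obtain g h where g: "g \<in> carrier G" "s = g \<otimes> x \<otimes> inv g"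
    and h: "h \<in> carrier G" "t = h \<otimes> x \<otimes> inv h" by blast
  define k where "k = inv g \<otimes> h"
  have k: "k \<in> carrier G" using g h by (simp add: k_def)
  have t: "t = g \<otimes> (k \<otimes> x \<otimes> inv k) \<otimes> inv g"
    using g h x by (simp add: k_def m_assoc inv_mult_group mult_inv_cancel)
  have "s \<otimes> t = g \<otimes> (x \<otimes> (k \<otimes> x \<otimes> inv k)) \<otimes> inv g"
    using g(1) k x by (simp add: t g(2) m_assoc mult_inv_cancel)
  also have "\<dots> = g \<otimes> ((k \<otimes> x \<otimes> inv k) \<otimes> x) \<otimes> inv g"
    by (simp only: commute_conj[OF x k])
  also have "\<dots> = t \<otimes> s"
    using g(1) k x by (simp add: t g(2) m_assoc mult_inv_cancel)
  finally show "s \<otimes> t = t \<otimes> s" .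
qed (use x in auto)

lemma commutator_in_normal_closure:
  assumes x: "x \<in> carrier G" and y: "y \<in> carrier G" and z: "z \<in> carrier G"
    and "x \<in> normal_closure z \<or> y \<in> normal_closure z"
  shows "commutator x y \<in> normal_closure z"
proof -
  interpret N: normal "normal_closure z" G by (rule normal_closure[OF z])
  have *: "commutator x y \<in> normal_closure z"
    if "x \<in> carrier G" "y \<in> carrier G" "y \<in> normal_closure z" for x y
    unfolding commutator_def using that by (intro N.m_closed N.inv_op_closed2 N.m_inv_closed)
  show ?thesis
    using * assms commutator_in_normal_swap[OF N.normal_axioms y x] by blast
qed

text \<open>[x,y] lies in the normal closures of both x and y, which are abelian.\<close>

lemma commutator_commute:
  assumes x: "x \<in> carrier G" and y: "y \<in> carrier G"
  shows "commutator x y \<otimes> x = x \<otimes> commutator x y" "commutator x y \<otimes> y = y \<otimes> commutator x y"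
  using normal_closure_commute[OF x commutator_in_normal_closure[OF x y x] normal_closure(2)[OF x]]
    normal_closure_commute[OF y commutator_in_normal_closure[OF x y y] normal_closure(2)[OF y]]
    normal_closure(2)[OF x] normal_closure(2)[OF y] by auto

end

section \<open>Three generators: the lower central series and finiteness\<close>

locale three_generated_two_engel_group = two_engel_group +
  fixes a b c
  assumes gens: "a \<in> carrier G" "b \<in> carrier G" "c \<in> carrier G"
    and generate_gens: "generate G {a, b, c} = carrier G"
begin

text \<open>\<open>triples\<close> generates the third term of the lower central series, and
  \<open>pairs\<close> together with \<open>triples\<close> the derived subgroup. Triples with a
  repeated generator are trivial by \<open>commutator_commute\<close>.\<close>

definition triples :: "'a set" where
  "triples = {commutator (commutator a b) c, commutator (commutator a c) b, commutator (commutator b c) a}"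

definition pairs :: "'a set" where
  "pairs = {commutator a b, commutator a c, commutator b c}"

lemma triples_carrier: "triples \<subseteq> carrier G"
  using gens by (auto simp: triples_def)

lemma pairs_carrier: "pairs \<subseteq> carrier G"
  using gens by (auto simp: pairs_def)

text \<open>Each such triple commutator lies in all three of the abelian normal closures of \<open>a\<close>, \<open>b\<close>
  and \<open>c\<close>, hence commutes with each generator.\<close>

lemma triples_central:
  assumes t: "t \<in> generate G triples" and g: "g \<in> carrier G"
  shows "t \<otimes> g = g \<otimes> t"
proof (rule generate_commute[OF triples_carrier _ _ t, of "{a, b, c}"])
  fix s z assume s: "s \<in> triples" and z: "z \<in> {a, b, c}"
  have zc: "z \<in> carrier G" using z gens by auto
  have "s \<in> normal_closure z"
    using s z gens normal_closure(2) unfolding triples_def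
    by (auto intro!: commutator_in_normal_closure)
  then show "s \<otimes> z = z \<otimes> s"
    using normal_closure_commute[OF zc] normal_closure(2)[OF zc] by blast
qed (use gens g generate_gens in auto)

text \<open>Any two of the three pairs share a generator, and so lie in one abelian normal
  closure.\<close>

lemma pairs_commute:
  assumes "s \<in> pairs" "t \<in> pairs"
  shows "s \<otimes> t = t \<otimes> s"
proof -
  have "\<exists>z\<in>{a, b, c}. s \<in> normal_closure z \<and> t \<in> normal_closure z"
    using assms gens normal_closure(2) unfolding pairs_def
    by (auto intro!: commutator_in_normal_closure)
  then show ?thesis using gens normal_closure_commute by blast
qed

lemma triples_normal: "generate G triples \<lhd> G"
proof (rule normal_invI[OF generate_is_subgroup[OF triples_carrier]])
  fix x t assume "x \<in> carrier G" and t: "t \<in> generate G triples"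
  then have "x \<otimes> t \<otimes> inv x = t"
    using generate_in_carrier[OF triples_carrier t]
    by (simp add: m_assoc flip: triples_central)
  then show "x \<otimes> t \<otimes> inv x \<in> generate G triples" using t by simp
qed

lemma commutator_pairs:
  assumes "h \<in> generate G (pairs \<union> triples)" "g \<in> carrier G"
  shows "commutator h g \<in> generate G triples"
proof (rule generate_commutator_in_normal[OF triples_normal _ _ _ assms(1)])
  fix s z assume s: "s \<in> pairs \<union> triples" and z: "z \<in> {a, b, c}"
  have zc: "z \<in> carrier G" using z gens by auto
  show "commutator s z \<in> generate G triples"
  proof (cases "s \<in> triples")
    case True
    then have "s \<in> carrier G" "s \<otimes> z = z \<otimes> s"
      using triples_carrier triples_central[OF generate.incl zc] by auto
    then show ?thesis using zc generate.one by (simp add: commutator_eq_one_iff[THEN iffD2])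
  next
    case False
    have "commutator s z = \<one> \<or> commutator s z \<in> triples"
      using False s z gens commutator_commute
      by (auto simp: pairs_def triples_def commutator_eq_one_iff)
    then show ?thesis by (auto intro: generate.intros)
  qed
qed (use assms pairs_carrier triples_carrier gens generate_gens in auto)

lemma pairs_normal: "generate G (pairs \<union> triples) \<lhd> G"
proof (rule normal_invI[OF generate_is_subgroup])
  fix x h assume x: "x \<in> carrier G" and h: "h \<in> generate G (pairs \<union> triples)"
  have hc: "h \<in> carrier G" using generate_in_carrier[OF _ h] pairs_carrier triples_carrier by blast
  have "commutator x h \<in> generate G triples"
    using commutator_in_normal_swap[OF triples_normal hc x commutator_pairs[OF h x]] .
  then have "commutator x h \<otimes> h \<in> generate G (pairs \<union> triples)"
    using mono_generate[of triples "pairs \<union> triples"] h by (auto intro: generate.eng)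
  then show "x \<otimes> h \<otimes> inv x \<in> generate G (pairs \<union> triples)"
    using x hc by (simp add: commutator_def m_assoc)
qed (use pairs_carrier triples_carrier in auto)

lemma commutator_in_pairs:
  assumes "x \<in> carrier G" "y \<in> carrier G"
  shows "commutator x y \<in> generate G (pairs \<union> triples)"
proof (rule generate_commutator_in_normal[OF pairs_normal])
  fix s t assume st: "s \<in> {a, b, c}" "t \<in> {a, b, c}"
  have "commutator s t = \<one> \<or> commutator s t \<in> pairs \<or> commutator t s \<in> pairs"
    using st gens by (auto simp: pairs_def commutator_eq_one_iff)
  then show "commutator s t \<in> generate G (pairs \<union> triples)"
  proof (elim disjE)
    assume "commutator t s \<in> pairs"
    then have "commutator t s \<in> generate G (pairs \<union> triples)" by (intro generate.incl) simp
    then show ?thesis using st gens by (intro commutator_in_normal_swap[OF pairs_normal, of t s]) auto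
  qed (auto intro: generate.intros)
qed (use assms gens generate_gens in auto)

text \<open>From [x,y]^n = [x^n,y] the n-th powers of commutators are central, so triple commutators
  have n-th power 1. The derived subgroup H is thus abelian and finitely generated, of exponent
  dividing n^2, hence finite. Adjoining a, b, c one after the other keeps the subgroup finite,
  because n-th powers lie in H.\<close>

lemma finite_if_power_in_pairs:
  assumes n: "n \<noteq> 0" and pow: "\<And>y. y \<in> carrier G \<Longrightarrow> y [^] (n::int) \<in> generate G (pairs \<union> triples)"
  shows "finite (carrier G)"
proof -
  define H where "H = generate G (pairs \<union> triples)"
  define T where "T = generate G triples"
  have sub: "pairs \<union> triples \<subseteq> carrier G" using pairs_carrier triples_carrier by blast
  have H: "subgroup H G" unfolding H_def by (rule generate_is_subgroup[OF sub])
  interpret H: normal H G unfolding H_def by (rule pairs_normal)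
  have u: "commutator x y [^] n \<in> T" if "x \<in> carrier G" "y \<in> carrier G" for x y
    using commutator_pairs[OF pow[OF that(1)] that(2)] that
    by (simp add: commutator_int_pow_left commutator_commute T_def)
  have t: "commutator (commutator x y) z [^] n = \<one>"
    if "x \<in> carrier G" "y \<in> carrier G" "z \<in> carrier G" for x y z
  proof -
    let ?w = "commutator (commutator x y) z"
    have "?w [^] n = commutator (commutator x y [^] n) z"
      using that by (simp add: commutator_int_pow_left commutator_commute)
    also have "\<dots> = \<one>"
      using that triples_central[OF u[unfolded T_def]] by (subst commutator_eq_one_iff) auto
    finally show ?thesis .
  qed
  have T1: "y [^] n = \<one>" if y: "y \<in> T" for y
  proof (rule generate_commuting_int_pow_eq_one[OF triples_carrier _ _ y[unfolded T_def]])
    show "s [^] n = \<one>" if "s \<in> triples" for s using that t gens by (auto simp: triples_def)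
    show "s \<otimes> s' = s' \<otimes> s" if "s \<in> triples" "s' \<in> triples" for s s'
      using that triples_carrier triples_central[OF generate.incl] by blast
  qed
  have "finite H"
    unfolding H_def
  proof (rule finite_generate_commuting[OF _ sub])
    fix x y assume xy: "x \<in> pairs \<union> triples" "y \<in> pairs \<union> triples"
    have tc: "s \<otimes> g = g \<otimes> s" if "s \<in> triples" "g \<in> pairs \<union> triples" for s g
      using triples_central[OF generate.incl] that sub by blast
    show "x \<otimes> y = y \<otimes> x"
      using xy tc[of x y] tc[of y x] pairs_commute[of x y] by auto
  next
    fix x assume x: "x \<in> pairs \<union> triples"
    have "x [^] n \<in> T"
    proof (cases "x \<in> pairs")
      case True
      then show ?thesis using u gens by (auto simp: pairs_def)
    next
      case False
      then have "x [^] n = \<one>" using x by (intro T1) (auto simp: T_def intro: generate.incl)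
      then show ?thesis by (simp add: T_def generate.one)
    qed
    then have "x [^] (n * n) = \<one>" using T1[of "x [^] n"] x sub by (auto simp: int_pow_pow)
    then show "x [^] \<bar>n * n\<bar> = \<one>" by (simp add: abs_mult)
  qed (use n in \<open>auto simp: pairs_def triples_def zero_less_mult_iff\<close>)
  \<comment> \<open>Every subgroup containing all commutators is normal, as x k x^-1 = [x,k]
    k.\<close>
  have norm: "x \<otimes> k \<otimes> inv x \<in> K" if K: "subgroup K G" "H \<subseteq> K" and x: "x \<in> carrier G" and k: "k \<in> K"
    for K x k
  proof -
    have kc: "k \<in> carrier G" using subgroup.mem_carrier[OF K(1) k] .
    have "commutator x k \<otimes> k \<in> K"
      using commutator_in_pairs[OF x kc] K k by (intro subgroup.m_closed[OF K(1)]) (auto simp: H_def)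
    then show ?thesis using x kc by (simp add: commutator_def m_assoc)
  qed
  define ext where "ext x K = {k \<otimes> x [^] (i::int) | k i. k \<in> K}" for x K
  have ext: "subgroup (ext x K) G \<and> H \<subseteq> ext x K \<and> finite (ext x K) \<and> insert x K \<subseteq> ext x K"
    if K: "subgroup K G" "H \<subseteq> K" "finite K" and x: "x \<in> carrier G" for x K
  proof -
    interpret K: subgroup K G by (rule K)
    have "subgroup (ext x K) G"
      unfolding ext_def using norm[OF K(1,2)] x by (intro subgroup_mult_int_pow K x) auto
    moreover have "x [^] \<bar>n\<bar> \<in> K"
    proof -
      have "x [^] n \<in> K" using pow[OF x] K(2) by (auto simp: H_def)
      then show ?thesis using x K.m_inv_closed by (auto simp: abs_if int_pow_neg)
    qed
    then have "finite (ext x K)"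
      unfolding ext_def using n by (intro finite_mult_int_pow[of K x "\<bar>n\<bar>"] K x) auto
    moreover have "k \<in> ext x K" if "k \<in> K" for k
      unfolding ext_def using that by (auto intro!: exI[of _ k] exI[of _ "0::int"])
    moreover have "x \<in> ext x K"
      unfolding ext_def using x by (auto intro!: exI[of _ \<one>] exI[of _ "1::int"])
    ultimately show ?thesis using K by auto
  qed
  have e1: "subgroup (ext a H) G \<and> H \<subseteq> ext a H \<and> finite (ext a H) \<and> insert a H \<subseteq> ext a H"
    by (rule ext) (use H \<open>finite H\<close> gens in auto)
  then have e2: "subgroup (ext b (ext a H)) G \<and> H \<subseteq> ext b (ext a H) \<and> finite (ext b (ext a H))
      \<and> insert b (ext a H) \<subseteq> ext b (ext a H)"
    by (intro ext) (use gens in auto)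
  then have e3: "subgroup (ext c (ext b (ext a H))) G \<and> H \<subseteq> ext c (ext b (ext a H))
      \<and> finite (ext c (ext b (ext a H))) \<and> insert c (ext b (ext a H)) \<subseteq> ext c (ext b (ext a H))"
    by (intro ext) (use gens in auto)
  have "generate G {a, b, c} \<subseteq> ext c (ext b (ext a H))"
    using e1 e2 e3 by (intro generate_subgroup_incl) auto
  then show ?thesis using e3 generate_gens finite_subset by auto
qed

text \<open>The abelianization has no finite exponent by \<open>finite_if_power_in_pairs\<close>, so
  it maps nontrivially to the integers; the map is pulled back to G.\<close>

lemma infinite_imp_hom_int:
  assumes inf: "infinite (carrier G)"
  obtains f :: "'a \<Rightarrow> int" and x
  where "\<And>y z. \<lbrakk>y \<in> carrier G; z \<in> carrier G\<rbrakk> \<Longrightarrow> f (y \<otimes> z) = f y + f z"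
    and "x \<in> carrier G" "f x \<noteq> 0"
proof -
  define H where "H = generate G (pairs \<union> triples)"
  interpret H: normal H G unfolding H_def by (rule pairs_normal)
  interpret Q: group "G Mod H" by (rule H.factorgroup_is_group)
  have hom: "(\<lambda>x. H #> x) \<in> hom G (G Mod H)" by (rule H.r_coset_hom_Mod)
  interpret h: group_hom G "G Mod H" "\<lambda>x. H #> x"
    using hom by (simp add: group_hom_def group_hom_axioms_def is_group Q.is_group)
  have carr: "carrier (G Mod H) = (\<lambda>x. H #> x) ` carrier G" by (rule carrier_FactGroup)
  have comm: "comm_group (G Mod H)"
  proof (rule Q.group_comm_groupI)
    fix X Y assume "X \<in> carrier (G Mod H)" "Y \<in> carrier (G Mod H)"
    then obtain x y where x: "x \<in> carrier G" "X = H #> x" and y: "y \<in> carrier G" "Y = H #> y"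
      using carr by auto
    have "H #> commutator x y = H"
      using commutator_in_pairs[OF x(1) y(1)] by (intro H.rcos_const) (simp_all add: H_def)
    then have "H #> (x \<otimes> y) = H #> (y \<otimes> x)"
      using x y mult_eq_commutator[of x y] H.subset
      by (metis commutator_closed coset_mult_assoc m_closed)
    then show "X \<otimes>\<^bsub>G Mod H\<^esub> Y = Y \<otimes>\<^bsub>G Mod H\<^esub> X"
      using x y by (simp only: h.hom_mult[symmetric])
  qed
  interpret Q: comm_group "G Mod H" by (rule comm)
  have gen: "generate (G Mod H) ((\<lambda>x. H #> x) ` {a, b, c}) = carrier (G Mod H)"
    using h.generate_img[of "{a, b, c}"] gens generate_gens carr by simp
  have unb: "\<nexists>n::int. n \<noteq> 0 \<and> (\<forall>Y\<in>carrier (G Mod H). Y [^]\<^bsub>G Mod H\<^esub> n = \<one>\<^bsub>G Mod H\<^esub>)"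
  proof
    assume "\<exists>n::int. n \<noteq> 0 \<and> (\<forall>Y\<in>carrier (G Mod H). Y [^]\<^bsub>G Mod H\<^esub> n = \<one>\<^bsub>G Mod H\<^esub>)"
    then obtain n :: int where n: "n \<noteq> 0" "\<And>Y. Y \<in> carrier (G Mod H) \<Longrightarrow> Y [^]\<^bsub>G Mod H\<^esub> n = \<one>\<^bsub>G Mod H\<^esub>"
      by blast
    have "y [^] n \<in> H" if y: "y \<in> carrier G" for y
    proof -
      have "H #> (y [^] n) = H" using n(2)[of "H #> y"] y carr by (simp add: h.hom_int_pow)
      then show ?thesis using y rcos_self[OF _ H.is_subgroup, of "y [^] n"] by simp
    qed
    then have "finite (carrier G)" using finite_if_power_in_pairs[OF n(1)] by (simp add: H_def)
    then show False using inf by simp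
  qed
  have fin: "finite ((\<lambda>x. H #> x) ` {a, b, c})" by simp
  have sub: "(\<lambda>x. H #> x) ` {a, b, c} \<subseteq> carrier (G Mod H)" using gens carr by auto
  show thesis
  proof (rule Q.unbounded_exponent_imp_hom_int[OF fin sub gen unb])
    fix f :: "'a set \<Rightarrow> int" and X
    assume f: "\<And>Y Z. \<lbrakk>Y \<in> carrier (G Mod H); Z \<in> carrier (G Mod H)\<rbrakk> \<Longrightarrow> f (Y \<otimes>\<^bsub>G Mod H\<^esub> Z) = f Y + f Z"
      and X: "X \<in> carrier (G Mod H)" "f X \<noteq> 0"
    obtain x where "x \<in> carrier G" "X = H #> x" using X carr by auto
    then show thesis
      using X by (intro that[of "\<lambda>y. f (H #> y)" x]) (simp_all add: h.hom_mult f del: mult_FactGroup)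
  qed
qed

end

lemma infinite_three_generator_E_group_imp_comm_group:
  assumes E: "E_group G" and gen: "generator_group 3 G" and inf: "infinite (carrier G)"
  shows "comm_group G"
proof -
  interpret two_engel_group G using E by (rule E_group_imp_two_engel_group)
  obtain S where S: "S \<subseteq> carrier G" "finite S" "card S \<le> 3" "generate G S = carrier G"
    using gen by (auto simp: generator_group_def)
  obtain xs where xs: "set xs = S" "length xs \<le> 3"
    using finite_distinct_list[OF S(2)] S(3) by (metis distinct_card)
  \<comment> \<open>Padding with the identity gives exactly three generators.\<close>
  define ys where "ys = xs @ replicate (3 - length xs) \<one>\<^bsub>G\<^esub>"
  have "length ys = 3" "S \<subseteq> set ys" "set ys \<subseteq> carrier G"
    using xs S by (auto simp: ys_def)
  then obtain a b c where abc: "S \<subseteq> {a, b, c}" "{a, b, c} \<subseteq> carrier G"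
    by (auto simp: numeral_3_eq_3 length_Suc_conv)
  have "generate G {a, b, c} = carrier G"
    using mono_generate[OF abc(1)] generate_incl[OF abc(2)] S(4) by simp
  then interpret three_generated_two_engel_group G a b c
    using abc(2) by unfold_locales auto
  obtain f :: "'a \<Rightarrow> int" and x
    where "\<And>y z. \<lbrakk>y \<in> carrier G; z \<in> carrier G\<rbrakk> \<Longrightarrow> f (y \<otimes>\<^bsub>G\<^esub> z) = f y + f z"
      and "x \<in> carrier G" "f x \<noteq> 0"
    using infinite_imp_hom_int[OF inf] by blast
  then show ?thesis by (rule E_group_hom_int_imp_comm_group[OF E])
qed

section \<open>Two-generator groups of class two\<close>

lemma two_mult_choose_two: "2 * (n choose 2) = n * (n - 1)"
  by (cases n) (simp_all add: choose_two)

text \<open>Generation is left out so that the locale also applies to the intended images of a, b, c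
  under an endomorphism. The last assumption makes c the commutator of a and b.\<close>

locale class_two_pair = group +
  fixes a b c
  assumes pair_closed [simp]: "a \<in> carrier G" "b \<in> carrier G" "c \<in> carrier G"
    and c_commute: "c \<otimes> a = a \<otimes> c" "c \<otimes> b = b \<otimes> c"
    and ab: "a \<otimes> b = c \<otimes> (b \<otimes> a)"
begin

definition nf :: "int \<Rightarrow> int \<Rightarrow> int \<Rightarrow> 'a" where
  "nf k l h = a [^] k \<otimes> b [^] l \<otimes> c [^] h"

lemma nf_closed [simp]: "nf k l h \<in> carrier G"
  by (simp add: nf_def)

lemma nf_simps: "nf 0 0 h = c [^] h" "nf 1 0 0 = a" "nf 0 1 0 = b" "nf k 0 0 = a [^] k" "nf 0 l 0 = b [^] l"
  by (simp_all add: nf_def)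

text \<open>Moving a^k' to the left past b^l costs the central factor c^(-l k'): this is the
  multiplication of an integral Heisenberg group.\<close>

lemma nf_mult: "nf k l h \<otimes> nf k' l' h' = nf (k + k') (l + l') (h + h' - l * k')"
proof -
  have tail: "x \<otimes> (y \<otimes> z) = v \<otimes> (w \<otimes> z)"
    if "x \<otimes> y = v \<otimes> w" "x \<in> carrier G" "y \<in> carrier G" "v \<in> carrier G" "w \<in> carrier G" "z \<in> carrier G"
    for x y z v w
    using that by (simp flip: m_assoc)
  have ca: "c [^] j \<otimes> a [^] i = a [^] i \<otimes> c [^] j" for i j :: int
    by (rule int_pow_commute) (simp_all add: c_commute)
  have cb: "c [^] j \<otimes> b [^] i = b [^] i \<otimes> c [^] j" for i j :: int
    by (rule int_pow_commute) (simp_all add: c_commute)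
  have "a [^] k' \<otimes> b [^] l = c [^] (k' * l) \<otimes> (b [^] l \<otimes> a [^] k')"
    by (rule class_two_int_pow_mult) (simp_all add: c_commute ab)
  then have "b [^] l \<otimes> a [^] k' = c [^] (- (k' * l)) \<otimes> (a [^] k' \<otimes> b [^] l)"
    by (simp add: int_pow_neg mult_inv_cancel)
  also have "\<dots> = a [^] k' \<otimes> (b [^] l \<otimes> c [^] (- (k' * l)))"
    by (subst tail[OF ca]) (simp_all add: cb)
  finally have ba: "b [^] l \<otimes> a [^] k' = a [^] k' \<otimes> (b [^] l \<otimes> c [^] (- (k' * l)))" .
  have "nf k l h \<otimes> nf k' l' h' = a [^] k \<otimes> (b [^] l \<otimes> (a [^] k' \<otimes> (b [^] l' \<otimes> (c [^] h \<otimes> c [^] h'))))"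
    by (simp add: nf_def m_assoc tail[OF ca] tail[OF cb])
  also have "\<dots> = a [^] k \<otimes> (a [^] k' \<otimes> (b [^] l \<otimes> (b [^] l' \<otimes> (c [^] (- (k' * l)) \<otimes> (c [^] h \<otimes> c [^] h')))))"
    by (subst tail[OF ba]) (simp_all add: m_assoc tail[OF cb])
  also have "\<dots> = a [^] (k + k') \<otimes> (b [^] (l + l') \<otimes> c [^] (- (k' * l) + h + h'))"
    by (simp only: int_pow_mult m_assoc pair_closed int_pow_closed m_closed)
  finally show ?thesis by (simp add: nf_def m_assoc algebra_simps)
qed

text \<open>The third exponent is the one for which multiplying by \<open>nf k' l' h'\<close> gives
  back \<open>nf k l h\<close>. Relations modulo c are thus closed under differences.\<close>

lemma nf_eq_one_diff:
  assumes "nf k l h = \<one>" "nf k' l' h' = \<one>"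
  shows "nf (k - k') (l - l') (h - h' + (l - l') * k') = \<one>"
  using nf_mult[of "k - k'" "l - l'" "h - h' + (l - l') * k'" k' l' h'] assms by simp

lemma nf_pow: "nf k l h [^] (n::nat) = nf (int n * k) (int n * l) (int n * h - k * l * int (n choose 2))"
proof (induction n)
  case 0
  then show ?case by (simp add: nf_def binomial_eq_0)
next
  case (Suc n)
  have "Suc n choose 2 = n + (n choose 2)" by (simp add: numeral_2_eq_2)
  then show ?case using Suc by (simp add: nf_mult algebra_simps)
qed

lemma nf_commute_imp:
  assumes "nf k l h \<otimes> nf k' l' h' = nf k' l' h' \<otimes> nf k l h"
  shows "c [^] (l * k' - l' * k) = \<one>"
proof -
  let ?x = "a [^] (k + k') \<otimes> b [^] (l + l')"
  have "?x \<otimes> c [^] (h + h' - l * k') = ?x \<otimes> c [^] (h + h' - l' * k)"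
    using assms by (simp add: nf_mult) (simp add: nf_def add.commute)
  then have eq: "c [^] (h + h' - l * k') = c [^] (h + h' - l' * k)" by simp
  have "c [^] (X - Y) = \<one>" if "c [^] Y = c [^] X" for X Y :: int
    by (simp add: int_pow_diff that)
  from this[OF eq] show ?thesis by (simp add: algebra_simps)
qed

end

section \<open>Endomorphisms of two-generated groups of class two\<close>

locale two_generated_class_two_group = class_two_pair +
  assumes generate_pair: "generate G {a, b} = carrier G"
begin

lemma nf_surj:
  assumes "x \<in> carrier G"
  obtains k l h where "x = nf k l h"
proof -
  have "x \<in> generate G {a, b}" using assms generate_pair by simp
  then have "\<exists>k l h. x = nf k l h"
  proof (induction rule: generate.induct)
    case one
    then show ?case by (intro exI[of _ 0]) (simp add: nf_def)
  next
    case (incl h)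
    then have "h = nf 1 0 0 \<or> h = nf 0 1 0" by (auto simp: nf_simps)
    then show ?case by blast
  next
    case (inv h)
    then have "inv h = nf (-1) 0 0 \<or> inv h = nf 0 (-1) 0" by (auto simp: nf_def int_pow_neg)
    then show ?case by blast
  qed (use nf_mult in metis)
  then show thesis using that by blast
qed

text \<open>Normal forms multiply by the same law in the source and for A, B, Z. Two normal forms of
  one element differ by a relation, which \<open>rel\<close> sends to 1, so the map is well
  defined.\<close>

lemma hom_exists:
  assumes "class_two_pair G A B Z"
    and rel: "\<And>k l h. nf k l h = \<one> \<Longrightarrow> A [^] k \<otimes> B [^] l \<otimes> Z [^] h = \<one>"
  obtains \<alpha> where "\<alpha> \<in> hom G G" "\<And>k l h. \<alpha> (nf k l h) = A [^] k \<otimes> B [^] l \<otimes> Z [^] h"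
proof -
  interpret T: class_two_pair G A B Z by fact
  define \<alpha> where "\<alpha> x = (SOME y. \<exists>k l h. x = nf k l h \<and> y = T.nf k l h)" for x
  have wd: "T.nf k l h = T.nf k' l' h'" if eq: "nf k l h = nf k' l' h'" for k l h k' l' h'
  proof -
    let ?h = "h - h' + (l - l') * k'"
    have "nf (k - k') (l - l') ?h \<otimes> nf k' l' h' = \<one> \<otimes> nf k' l' h'"
      by (simp add: nf_mult eq)
    then have "nf (k - k') (l - l') ?h = \<one>" by (simp del: l_one)
    then have "T.nf (k - k') (l - l') ?h = \<one>" using rel by (simp add: T.nf_def)
    then have "T.nf (k - k') (l - l') ?h \<otimes> T.nf k' l' h' = T.nf k' l' h'" by simp
    then show ?thesis by (simp add: T.nf_mult)
  qed
  have \<alpha>: "\<alpha> (nf k l h) = T.nf k l h" for k l h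
    unfolding \<alpha>_def
  proof (rule some_equality)
    fix y assume "\<exists>k' l' h'. nf k l h = nf k' l' h' \<and> y = T.nf k' l' h'"
    then obtain k' l' h' where eq: "nf k l h = nf k' l' h'" and y: "y = T.nf k' l' h'" by blast
    show "y = T.nf k l h" unfolding y by (rule wd[OF eq, symmetric])
  qed blast
  have "\<alpha> \<in> hom G G"
  proof (rule homI)
    fix x assume "x \<in> carrier G"
    then obtain k l h where "x = nf k l h" by (rule nf_surj)
    then show "\<alpha> x \<in> carrier G" by (simp add: \<alpha>)
  next
    fix x y assume x: "x \<in> carrier G" and y: "y \<in> carrier G"
    obtain k l h where "x = nf k l h" using x by (rule nf_surj)
    moreover obtain k' l' h' where "y = nf k' l' h'" using y by (rule nf_surj)
    ultimately show "\<alpha> (x \<otimes> y) = \<alpha> x \<otimes> \<alpha> y"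
      by (simp add: nf_mult \<alpha> T.nf_mult)
  qed
  then show thesis using that \<alpha> by (simp add: T.nf_def)
qed

text \<open>By \<open>rel\<close>, sending a to g, b to g^t and c to 1 defines an endomorphism. The
  condition at a, b and a b makes g commute with a, g^t with b, and g^(1+t) with a b and hence with
  b. The quotient of the last two powers is g.\<close>

lemma E_group_cyclic_quotient_imp_commute:
  assumes E: "E_group G" and rel: "\<And>k l h. nf k l h = \<one> \<Longrightarrow> m dvd k + t * l"
    and g: "g \<in> carrier G" "g [^] (m::int) = \<one>"
  shows "g \<otimes> a = a \<otimes> g" "g \<otimes> b = b \<otimes> g"
proof -
  have T: "class_two_pair G g (g [^] t) \<one>"
    using g int_pow_commute[of g g 1 t] by unfold_locales auto
  have eq: "g [^] k \<otimes> (g [^] t) [^] l \<otimes> \<one> [^] h = g [^] (k + t * l)" for k l h :: int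
    using g by (simp add: int_pow_pow int_pow_mult)
  have "g [^] (k + t * l) = \<one>" if nf: "nf k l h = \<one>" for k l h
  proof -
    obtain q where "k + t * l = m * q" using rel[OF nf] by blast
    then show ?thesis using g by (simp flip: int_pow_pow)
  qed
  then obtain \<alpha> where \<alpha>: "\<alpha> \<in> hom G G" "\<And>k l h. \<alpha> (nf k l h) = g [^] (k + t * l)"
    using hom_exists[OF T] unfolding eq by blast
  have comm: "nf k l h \<otimes> g [^] (k + t * l) = g [^] (k + t * l) \<otimes> nf k l h" for k l h
    using E \<alpha> by (metis E_group_def nf_closed)
  show ga: "g \<otimes> a = a \<otimes> g" using comm[of 1 0 0] g by (simp add: nf_simps)
  have sub: "subgroup {h \<in> carrier G. \<forall>s\<in>{b}. h \<otimes> s = s \<otimes> h} G"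
    by (rule subgroup_centralizer) simp
  have gt: "g [^] t \<otimes> b = b \<otimes> g [^] t" using comm[of 0 1 0] by (simp add: nf_simps)
  have "g [^] (1 + t) \<otimes> (inv a \<otimes> (a \<otimes> b)) = (inv a \<otimes> (a \<otimes> b)) \<otimes> g [^] (1 + t)"
  proof (rule generate_commute[of "{g [^] (1 + t)}" "{a, a \<otimes> b}"])
    have "g [^] (1 + t) \<otimes> a = a \<otimes> g [^] (1 + t)"
      using int_pow_commute[of g a "1 + t" 1] g ga by simp
    moreover have "g [^] (1 + t) \<otimes> (a \<otimes> b) = (a \<otimes> b) \<otimes> g [^] (1 + t)"
      using comm[of 1 1 0] by (simp add: nf_def)
    ultimately show "s \<otimes> z = z \<otimes> s" if "s \<in> {g [^] (1 + t)}" "z \<in> {a, a \<otimes> b}" for s z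
      using that by auto
  qed (use g in \<open>auto intro: generate.intros\<close>)
  then have "g [^] (1 + t) \<otimes> b = b \<otimes> g [^] (1 + t)" by (simp add: mult_inv_cancel)
  then have "g [^] (1 + t) \<otimes> inv (g [^] t) \<in> {h \<in> carrier G. \<forall>s\<in>{b}. h \<otimes> s = s \<otimes> h}"
    using gt g by (intro subgroup.m_closed[OF sub] subgroup.m_inv_closed[OF sub]) auto
  then show "g \<otimes> b = b \<otimes> g" using g by (simp add: int_pow_mult m_assoc)
qed

end

text \<open>R is generated by some (k0,d), where d generates the second projection, and by vectors
  (k,0), for which m divides k. So only k0 + t d = 0 modulo m must be solved, which is possible once
  gcd(d,m) divides k0.\<close>

lemma int_relations_character:
  fixes R :: "(int \<times> int) set" and m n' :: int
  assumes diff: "\<And>k l k' l'. \<lbrakk>(k, l) \<in> R; (k', l') \<in> R\<rbrakk> \<Longrightarrow> (k - k', l - l') \<in> R"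
    and n: "(0, m * n') \<in> R" "m * n' \<noteq> 0" and cop: "coprime m n'"
    and m: "\<And>k. (k, 0) \<in> R \<Longrightarrow> m dvd k"
  obtains t where "\<And>k l. (k, l) \<in> R \<Longrightarrow> m dvd k + t * l"
proof -
  have zero: "(0, 0) \<in> R" using diff[OF n(1) n(1)] by simp
  have neg: "(- k, - l) \<in> R" if "(k, l) \<in> R" for k l using diff[OF zero that] by simp
  have mult_nat: "(int q * k, int q * l) \<in> R" if kl: "(k, l) \<in> R" for k l q
  proof (induction q)
    case (Suc q)
    from diff[OF Suc neg[OF kl]] show ?case by (simp add: algebra_simps)
  qed (use zero in auto)
  have mult: "(q * k, q * l) \<in> R" if kl: "(k, l) \<in> R" for k l q
    by (cases q rule: int_cases2) (use mult_nat[OF kl] neg in force)+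
  obtain d where d: "d > 0" "d \<in> snd ` R" "\<And>l. l \<in> snd ` R \<Longrightarrow> d dvd l"
  proof (rule int_set_diff_closed_dvd[of "snd ` R" "m * n'"])
    fix x y assume "x \<in> snd ` R" "y \<in> snd ` R"
    then show "x - y \<in> snd ` R" using diff by force
  qed (use n in force)+
  obtain k0 where k0: "(k0, d) \<in> R" using d(2) by auto
  obtain q where q: "m * n' = d * q" using d(3)[of "m * n'"] n(1) by force
  \<comment> \<open>This vector has second entry 0, so m divides q k0. With d q = m n' it follows
    that d divides k0 n', and coprimality removes n' from the divisibility by gcd(d,m).\<close>
  have "(q * k0 - 0, q * d - m * n') \<in> R" by (rule diff[OF mult[OF k0] n(1)])
  then have "m dvd q * k0" using m q by (simp add: mult.commute)
  then obtain e where e: "q * k0 = m * e" by blast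
  have "q * (k0 * n') = q * (e * d)"
  proof -
    have "q * (k0 * n') = (m * n') * e" by (simp add: e flip: mult.assoc) 
    also have "\<dots> = q * (e * d)" by (simp add: q)
    finally show ?thesis .
  qed
  then have "d dvd k0 * n'" using q n(2) by auto
  then have "gcd d m dvd k0 * n'" by (meson dvd_trans gcd_dvd1)
  moreover have "coprime (gcd d m) n'" using cop by (meson coprime_divisors dvd_refl gcd_dvd2)
  ultimately have "gcd d m dvd k0" by (simp add: coprime_dvd_mult_left_iff)
  then obtain f where f: "k0 = gcd d m * f" by blast
  obtain u v where uv: "u * d + v * m = gcd d m" using bezout_int by blast
  show thesis
  proof (rule that[of "- u * f"])
    fix k l assume kl: "(k, l) \<in> R"
    obtain s where s: "l = d * s" using d(3)[of l] kl by force
    have "(k - s * k0, l - s * d) \<in> R" by (rule diff[OF kl mult[OF k0]])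
    then have "m dvd k - s * k0" using m s by (simp add: mult.commute)
    moreover have "k + - u * f * l = (k - s * k0) + m * (v * f * s)"
    proof -
      have "k0 = (u * d + v * m) * f" using f uv by simp
      then show ?thesis using s by (simp add: algebra_simps)
    qed
    ultimately show "m dvd k + - u * f * l" by (simp only: dvd_add_left_iff dvd_add dvd_triv_left)
  qed
qed

section \<open>Finite two-generator E-groups\<close>

context two_generated_class_two_group
begin

lemma swap: "two_generated_class_two_group G b a (inv c)"
proof unfold_locales
  show "inv c \<otimes> b = b \<otimes> inv c" "inv c \<otimes> a = a \<otimes> inv c"
    using int_pow_commute[of c a "-1" 1] int_pow_commute[of c b "-1" 1]
    by (simp_all add: c_commute int_pow_neg)
  show "b \<otimes> a = inv c \<otimes> (a \<otimes> b)" by (simp add: ab mult_inv_cancel)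
  show "generate G {b, a} = carrier G" using generate_pair by (simp add: insert_commute)
qed auto

text \<open>The relations modulo c form the set R, and the character of R into the integers modulo m
  supplies the t for \<open>E_group_cyclic_quotient_imp_commute\<close>.\<close>

lemma E_group_power_eq_one_imp_commute:
  fixes m n' :: int
  assumes E: "E_group G" and mn: "m * n' \<noteq> 0" "coprime m n'"
    and a: "\<And>k h. a [^] (k::int) = c [^] (h::int) \<Longrightarrow> m dvd k"
    and b: "b [^] (m * n') = c [^] (i::int)"
    and g: "g \<in> carrier G" "g [^] m = \<one>"
  shows "g \<otimes> a = a \<otimes> g" "g \<otimes> b = b \<otimes> g"
proof -
  define R where "R = {(k, l). \<exists>h. nf k l h = \<one>}"
  obtain t where t: "\<And>k l. (k, l) \<in> R \<Longrightarrow> m dvd k + t * l"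
  proof (rule int_relations_character[of R m n'])
    show "(k - k', l - l') \<in> R" if "(k, l) \<in> R" "(k', l') \<in> R" for k l k' l'
      using that nf_eq_one_diff unfolding R_def by blast
    have "nf 0 (m * n') (- i) = \<one>" using b by (simp add: nf_def int_pow_neg)
    then show "(0, m * n') \<in> R" unfolding R_def by blast
    show "m dvd k" if k: "(k, 0) \<in> R" for k
    proof -
      obtain h where "nf k 0 h = \<one>" using k unfolding R_def by blast
      then have "a [^] k \<otimes> c [^] h = c [^] (- h) \<otimes> c [^] h" by (simp add: nf_def flip: int_pow_mult)
      then have "a [^] k = c [^] (- h)" by simp
      then show ?thesis by (rule a)
    qed
  qed (use mn in auto)
  have rel: "m dvd k + t * l" if "nf k l h = \<one>" for k l h
    by (rule t) (use that in \<open>auto simp: R_def\<close>)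
  show "g \<otimes> a = a \<otimes> g" "g \<otimes> b = b \<otimes> g"
    using E_group_cyclic_quotient_imp_commute[OF E rel g] by auto
qed

text \<open>d is the order of x modulo the subgroup generated by c.\<close>

lemma order_mod_c:
  assumes fin: "finite (carrier G)" and x: "x \<in> carrier G"
  obtains d :: nat where "d > 0" "\<And>k. (\<exists>h::int. x [^] (k::int) = c [^] h) \<longleftrightarrow> int d dvd k"
proof -
  define S where "S = {k::int. \<exists>h::int. x [^] k = c [^] h}"
  have "x [^] int (ord x) = c [^] (0::int)" using x by (simp add: int_pow_int)
  then have ord: "int (ord x) \<in> S" "int (ord x) \<noteq> 0"
    using ord_ge_1[OF fin x] unfolding S_def by (blast, simp)
  have diff: "k - l \<in> S" if kl: "k \<in> S" "l \<in> S" for k l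
  proof -
    obtain h h' where "x [^] k = c [^] (h::int)" "x [^] l = c [^] (h'::int)"
      using kl unfolding S_def by blast
    then have "x [^] (k - l) = c [^] (h - h')" using x by (simp add: int_pow_diff)
    then show ?thesis unfolding S_def by blast
  qed
  obtain d where d: "d > 0" "d \<in> S" "\<And>k. k \<in> S \<Longrightarrow> d dvd k"
    using int_set_diff_closed_dvd[OF diff ord] by blast
  have "k \<in> S" if dk: "d dvd k" for k
  proof -
    obtain q where "k = d * q" using dk by blast
    moreover obtain h where "x [^] d = c [^] (h::int)" using d(2) by (auto simp: S_def)
    ultimately have "x [^] k = c [^] (h * q)" using x by (simp flip: int_pow_pow)
    then show ?thesis unfolding S_def by blast
  qed
  then have "k \<in> S \<longleftrightarrow> int (nat d) dvd k" for k using d by auto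
  then show thesis using that[of "nat d"] d(1) unfolding S_def by simp
qed

text \<open>m is the p-part of the least common multiple n of the orders of a and b modulo c. It
  divides one of these orders, since the multiplicity of p in n is the maximum of the two; if that
  is the order of b, the generators are exchanged.\<close>

lemma E_group_prime_exponent:
  assumes E: "E_group G" and fin: "finite (carrier G)" and p: "prime (p::nat)"
  obtains m n' :: nat and i j :: int
  where "m * n' > 0" "\<not> p dvd n'" "a [^] (m * n') = c [^] i" "b [^] (m * n') = c [^] j"
    "\<And>g. \<lbrakk>g \<in> carrier G; g [^] m = \<one>\<rbrakk> \<Longrightarrow> g \<otimes> a = a \<otimes> g \<and> g \<otimes> b = b \<otimes> g"
proof -
  obtain d where d: "d > 0" "\<And>k. (\<exists>h::int. a [^] (k::int) = c [^] h) \<longleftrightarrow> int d dvd k"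
    using order_mod_c[OF fin, of a] by auto
  obtain e where e: "e > 0" "\<And>k. (\<exists>h::int. b [^] (k::int) = c [^] h) \<longleftrightarrow> int e dvd k"
    using order_mod_c[OF fin, of b] by auto
  have unit: "\<not> is_unit p" using prime_gt_1_nat[OF p] by simp
  define n where "n = lcm d e"
  have n: "n > 0" using d e by (simp add: n_def lcm_pos_nat)
  obtain n' where n': "n = p ^ multiplicity p n * n'" "\<not> p dvd n'"
    using multiplicity_decompose'[of n p] n unit by blast
  define m where "m = p ^ multiplicity p n"
  have nm: "n = m * n'" unfolding m_def by (rule n'(1))
  have "coprime m n'" using p n'(2) by (auto simp: m_def prime_imp_coprime)
  then have cop: "coprime (int m) (int n')" by simp
  have nz: "int m * int n' \<noteq> 0" using n nm by simp
  have int_n: "int n = int m * int n'" by (subst nm) simp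
  have "int d dvd int n" "int e dvd int n" by (simp_all add: n_def)
  then obtain i j where i: "a [^] (int m * int n') = c [^] (i::int)"
    and j: "b [^] (int m * int n') = c [^] (j::int)"
    using d(2)[of "int n"] e(2)[of "int n"] unfolding int_n by blast
  have "multiplicity p n = max (multiplicity p d) (multiplicity p e)"
    using d e p by (simp add: n_def multiplicity_lcm)
  then have "m dvd d \<or> m dvd e" unfolding m_def by (metis max_def multiplicity_dvd)
  then have "g \<otimes> a = a \<otimes> g \<and> g \<otimes> b = b \<otimes> g" if g: "g \<in> carrier G" "g [^] m = \<one>" for g
  proof
    have g': "g [^] int m = \<one>" using g by (simp add: int_pow_int)
    assume "m dvd d"
    then have "int m dvd k" if "a [^] k = c [^] h" for k h :: int
      using that d(2)[of k] by (meson dvd_trans int_dvd_int_iff)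
    from E_group_power_eq_one_imp_commute[OF E nz cop this j g(1) g'] show ?thesis by simp
  next
    have g': "g [^] int m = \<one>" using g by (simp add: int_pow_int)
    interpret S: two_generated_class_two_group G b a "inv c" by (rule swap)
    assume "m dvd e"
    have dvd: "int m dvd k" if "b [^] k = inv c [^] h" for k h :: int
    proof -
      have "b [^] k = c [^] (- h)" using that by (simp add: int_pow_inv int_pow_neg)
      then have "int e dvd k" using e(2) by blast
      then show ?thesis using \<open>m dvd e\<close> by (meson dvd_trans int_dvd_int_iff)
    qed
    have "a [^] (int m * int n') = inv c [^] (- i)"
      unfolding i by (simp add: int_pow_inv int_pow_neg)
    from S.E_group_power_eq_one_imp_commute[OF E nz cop dvd this g(1) g'] show ?thesis by simp
  qed
  moreover have "a [^] (m * n') = c [^] i" "b [^] (m * n') = c [^] j"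
    using i j by (simp_all only: int_pow_int flip: of_nat_mult)
  moreover have "m * n' > 0" using n nm by simp
  ultimately show thesis using n'(2) by (intro that[of m n' i j]) simp_all
qed

lemma ord_c_dvd_if_commute:
  assumes "nf k l h \<otimes> a = a \<otimes> nf k l h" "nf k l h \<otimes> b = b \<otimes> nf k l h"
  shows "int (ord c) dvd l" "int (ord c) dvd k"
  using nf_commute_imp[of k l h 1 0 0] nf_commute_imp[of k l h 0 1 0] assms
  by (simp_all add: nf_simps int_pow_eq_id)

text \<open>The remaining configuration contains a quaternion group; exchanging two generators
  of the latter is an endomorphism which violates the condition.\<close>

lemma E_group_quaternion_case_impossible:
  fixes q :: nat
  assumes E: "E_group G" and q: "odd q" and ord: "even (ord c)" "ord c dvd 2 * q"
    and a: "a [^] (2 * q) = c [^] (i::int)" "odd i"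
    and b: "b [^] (2 * q) = c [^] (j::int)" "odd j"
  shows False
proof -
  \<comment> \<open>Exponents of c matter only modulo 2q.\<close>
  have c_eq: "c [^] x = c [^] y" if "int (2 * q) dvd x - y" for x y :: int
  proof -
    have "int (ord c) dvd x - y" using ord(2) that by (metis dvd_trans int_dvd_int_iff)
    then show ?thesis by (simp add: int_pow_eq dvd_diff_commute)
  qed
  \<comment> \<open>Since i is odd, the second factor q turns (a^q)^2 = c^i into (a^Q)^2 = c^q, and
    likewise for b. As c^q is an involution, a^Q and b^Q behave as generators of a quaternion
    group.\<close>
  define Q where "Q = int q * int q"
  have a2: "a [^] (Q * (2 * k)) = c [^] (int q * k)" for k
  proof -
    have "a [^] (Q * (2 * k)) = (a [^] int (2 * q)) [^] (int q * k)"
      by (simp add: int_pow_pow Q_def algebra_simps)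
    also have "\<dots> = c [^] (i * (int q * k))"
      using a(1) by (simp only: int_pow_int int_pow_pow pair_closed)
    also have "\<dots> = c [^] (int q * k)"
    proof (rule c_eq)
      obtain i' where "i = 2 * i' + 1" using a(2) by (elim oddE)
      then have "i * (int q * k) - int q * k = int (2 * q) * (i' * k)" by (simp add: algebra_simps)
      then show "int (2 * q) dvd i * (int q * k) - int q * k" by simp
    qed
    finally show ?thesis .
  qed
  have b2: "b [^] (Q * (2 * k)) = c [^] (int q * k)" for k
  proof -
    have "b [^] (Q * (2 * k)) = (b [^] int (2 * q)) [^] (int q * k)"
      by (simp add: int_pow_pow Q_def algebra_simps)
    also have "\<dots> = c [^] (j * (int q * k))"
      using b(1) by (simp only: int_pow_int int_pow_pow pair_closed)
    also have "\<dots> = c [^] (int q * k)"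
    proof (rule c_eq)
      obtain j' where "j = 2 * j' + 1" using b(2) by (elim oddE)
      then have "j * (int q * k) - int q * k = int (2 * q) * (j' * k)" by (simp add: algebra_simps)
      then show "int (2 * q) dvd j * (int q * k) - int q * k" by simp
    qed
    finally show ?thesis .
  qed
  obtain q' where q': "int q = 2 * q' + 1" using q by (metis even_of_nat oddE)
  have T: "class_two_pair G (b [^] Q) (a [^] Q) (c [^] int q)"
  proof unfold_locales
    show "c [^] int q \<otimes> b [^] Q = b [^] Q \<otimes> c [^] int q" "c [^] int q \<otimes> a [^] Q = a [^] Q \<otimes> c [^] int q"
      by (rule int_pow_commute, simp_all add: c_commute)+
    have "b [^] Q \<otimes> a [^] Q = nf Q Q (- (Q * Q))"
      using nf_mult[of 0 Q 0 Q 0 0] by (simp add: nf_simps)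
    also have "\<dots> = nf Q Q (int q)"
    proof -
      \<comment> \<open>Both -Q^2 and q are odd multiples of q, hence congruent modulo 2q.\<close>
      have "- (Q * Q) - int q = int (2 * q) * (- (1 + 3 * q' + 6 * (q' * q') + 4 * (q' * (q' * q'))))"
        by (simp add: Q_def q' algebra_simps)
      then have "c [^] (- (Q * Q)) = c [^] int q" by (intro c_eq) simp
      then show ?thesis by (simp add: nf_def)
    qed
    also have "\<dots> = nf 0 0 (int q) \<otimes> nf Q Q 0" by (subst nf_mult) simp
    also have "\<dots> = c [^] int q \<otimes> (a [^] Q \<otimes> b [^] Q)" by (simp add: nf_def)
    finally show "b [^] Q \<otimes> a [^] Q = c [^] int q \<otimes> (a [^] Q \<otimes> b [^] Q)" .
  qed auto
  have rel: "(b [^] Q) [^] k \<otimes> (a [^] Q) [^] l \<otimes> (c [^] int q) [^] h = \<one>"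
    if one: "nf k l h = \<one>" for k l h
  proof -
    \<comment> \<open>The identity is central, so the even number \<open>ord c\<close> divides k and
      l.\<close>
    have "even k" "even l"
      using ord_c_dvd_if_commute[of k l h] one ord(1) by (auto simp: one dest: dvd_trans[of 2 "int (ord c)"])
    then obtain k' l' where k': "k = 2 * k'" and l': "l = 2 * l'" by (elim evenE)
    define C where "C = int ((q * q) choose 2)"
    have C: "C = int (2 * q) * (int q * (q' * (q' + 1)))"
    proof -
      have "int (2 * ((q * q) choose 2)) = int ((q * q) * (q * q - 1))"
        by (simp only: two_mult_choose_two)
      moreover have "q * q > 0" using q by (auto intro: Nat.gr0I)
      then have "int (q * q - 1) = Q - 1" by (simp add: Q_def of_nat_diff)
      ultimately have "2 * C = Q * (Q - 1)"
        by (simp only: C_def Q_def of_nat_mult of_nat_numeral)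
      moreover have "Q - 1 = 4 * (q' * (q' + 1))" by (simp add: Q_def q' algebra_simps)
      ultimately show ?thesis by (simp add: Q_def)
    qed
    \<comment> \<open>The q^2-th power of the relation reduces to a power of c whose exponent is
      symmetric in k' and l'; exchanging a^Q and b^Q therefore respects it.\<close>
    have "\<one> = nf k l h [^] (q * q)" by (simp add: one)
    also have "\<dots> = nf (Q * k) (Q * l) (Q * h - k * l * C)" by (simp add: nf_pow Q_def C_def)
    also have "\<dots> = c [^] (int q * k' + int q * l' + (Q * h - k * l * C))"
      by (simp add: nf_def a2 b2 k' l' int_pow_mult)
    also have "\<dots> = c [^] (int q * k' + int q * l' + int q * h)"
    proof (rule c_eq)
      have "Q * h - int q * h = int (2 * q) * (q' * h)" by (simp add: Q_def q' algebra_simps)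
      then have "int q * k' + int q * l' + (Q * h - k * l * C) - (int q * k' + int q * l' + int q * h)
          = int (2 * q) * (q' * h - k * l * (int q * (q' * (q' + 1))))"
        unfolding C by (simp add: algebra_simps)
      then show "int (2 * q) dvd int q * k' + int q * l' + (Q * h - k * l * C) - (int q * k' + int q * l' + int q * h)"
        by simp
    qed
    also have "\<dots> = (b [^] Q) [^] k \<otimes> (a [^] Q) [^] l \<otimes> (c [^] int q) [^] h"
      by (simp add: int_pow_pow a2 b2 k' l' int_pow_mult)
    finally show ?thesis by simp
  qed
  obtain \<alpha> where \<alpha>: "\<alpha> \<in> hom G G"
    "\<And>k l h. \<alpha> (nf k l h) = (b [^] Q) [^] k \<otimes> (a [^] Q) [^] l \<otimes> (c [^] int q) [^] h"
    using hom_exists[OF T rel] by blast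
  have "\<alpha> a = b [^] Q" using \<alpha>(2)[of 1 0 0] by (simp add: nf_simps)
  then have "a \<otimes> b [^] Q = b [^] Q \<otimes> a" using E \<alpha>(1) by (metis E_group_def pair_closed(1))
  then have "int (ord c) dvd Q"
    using nf_commute_imp[of 0 Q 0 1 0 0] by (simp add: nf_simps int_pow_eq_id)
  then have "even Q" using ord(1) by (auto dest: dvd_trans[of 2 "int (ord c)"])
  then show False using q by (simp add: Q_def)
qed

lemma E_group_finite_imp_trivial_commutator:
  assumes E: "E_group G" and fin: "finite (carrier G)"
  shows "c = \<one>"
proof (rule ccontr)
  assume "c \<noteq> \<one>"
  then have "ord c \<noteq> 1" using ord_eq_1[of c] by simp
  then obtain p where p: "prime p" "p dvd ord c" using prime_factor_nat by blast
  then obtain r where r: "ord c = p * r" by blast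
  have r0: "r > 0" using r ord_ge_1[OF fin, of c] by (cases r) auto
  obtain m n' :: nat and i j :: int
    where n: "m * n' > 0" "\<not> p dvd n'" and a: "a [^] (m * n') = c [^] i" and b: "b [^] (m * n') = c [^] j"
    and central: "\<And>g. \<lbrakk>g \<in> carrier G; g [^] m = \<one>\<rbrakk> \<Longrightarrow> g \<otimes> a = a \<otimes> g \<and> g \<otimes> b = b \<otimes> g"
    by (rule E_group_prime_exponent[OF E fin p(1)]) blast
  define n where "n = m * n'"
  have an: "a [^] int n = c [^] i" and bn: "b [^] int n = c [^] j"
    using a b by (simp_all only: n_def int_pow_int)
  \<comment> \<open>a^n is a power of c and so commutes with b; this forces c^n = 1.\<close>
  have "nf (int n) 0 0 \<otimes> nf 0 1 0 = nf 0 1 0 \<otimes> nf (int n) 0 0"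
    using int_pow_commute[of c b i 1] by (simp add: nf_simps an c_commute)
  then have ord_n: "ord c dvd n"
    using nf_commute_imp[of "int n" 0 0 0 1 0] by (simp add: int_pow_eq_id)
  then have pn: "p dvd n" using p by (meson dvd_trans)
  define C where "C = int (n choose 2)"
  \<comment> \<open>The n-th power of a^k b^l is c to the displayed exponent. If p divides that
    exponent, then g = (a^k b^l)^(n' r) satisfies g^m = 1 because \<open>ord c\<close> is p r. So g
    is central, and p r divides both n' r k and n' r l.\<close>
  have star: "int p dvd k \<and> int p dvd l" if dvd: "int p dvd i * k + j * l - k * l * C" for k l
  proof -
    define g where "g = nf k l 0 [^] (n' * r)"
    have "g [^] m = (nf k l 0 [^] n) [^] r"
      by (simp add: g_def n_def nat_pow_pow ac_simps)
    also have "nf k l 0 [^] n = nf (int n * k) (int n * l) (- (k * l * C))"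
      by (simp add: nf_pow C_def)
    also have "\<dots> = (a [^] int n) [^] k \<otimes> (b [^] int n) [^] l \<otimes> c [^] (- (k * l * C))"
      by (simp only: nf_def int_pow_pow pair_closed)
    also have "\<dots> = c [^] (i * k + j * l + - (k * l * C))"
      by (simp only: an bn int_pow_pow int_pow_mult pair_closed)
    also have "i * k + j * l + - (k * l * C) = i * k + j * l - k * l * C" by simp
    also have "(c [^] (i * k + j * l - k * l * C)) [^] r = \<one>"
    proof -
      have "int (ord c) dvd (i * k + j * l - k * l * C) * int r"
        using dvd by (simp add: r mult_dvd_mono)
      then show ?thesis by (simp add: int_pow_pow int_pow_eq_id flip: int_pow_int)
    qed
    finally have "g \<otimes> a = a \<otimes> g \<and> g \<otimes> b = b \<otimes> g" by (intro central) (simp_all add: g_def)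
    then have "int (ord c) dvd int (n' * r) * l" "int (ord c) dvd int (n' * r) * k"
      unfolding g_def nf_pow using ord_c_dvd_if_commute by blast+
    then have "int r * int p dvd int r * (int n' * l)" "int r * int p dvd int r * (int n' * k)"
      by (simp_all add: r ac_simps)
    then have "int p dvd int n' * l" "int p dvd int n' * k" using r0 by simp_all
    then show ?thesis using n(2) p(1) by (simp add: prime_dvd_mult_iff)
  qed
  have i: "\<not> int p dvd i" using star[of 1 0] p(1) by auto
  have j: "\<not> int p dvd j" using star[of 0 1] p(1) by auto
  have "\<not> int p dvd C"
  proof
    assume "int p dvd C"
    \<comment> \<open>For k = j and l = -i the linear terms cancel and only i j C remains.\<close>
    then have "int p dvd j" using star[of j "- i"] by (simp add: algebra_simps)
    then show False using j by simp
  qed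
  then have C: "\<not> p dvd n choose 2" by (simp add: C_def)
  have n2: "n * (n - 1) = 2 * (n choose 2)" by (simp only: two_mult_choose_two)
  \<comment> \<open>p divides n (n - 1) = 2 C but not C.\<close>
  have "p dvd 2"
    using C n2 pn p(1) by (metis dvd_mult2 prime_dvd_multD)
  then have p2: "p = 2" using p(1) by (simp add: primes_dvd_imp_eq)
  obtain q where q: "n = 2 * q" using pn p2 by blast
  have "odd q"
  proof
    assume "even q"
    then have "even (q * (n - 1))" by simp
    also have "q * (n - 1) = n choose 2" using n2 q by simp
    finally show False using C p2 by simp
  qed
  moreover have "even (ord c)" "odd i" "odd j" using p i j p2 by simp_all
  moreover have "a [^] (2 * q) = c [^] i" "b [^] (2 * q) = c [^] j"
    using a b unfolding q[symmetric] n_def by simp_all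
  moreover have "ord c dvd 2 * q" using ord_n unfolding q .
  ultimately show False by (intro E_group_quaternion_case_impossible[OF E, of q i j])
qed

end

section \<open>The two equivalences\<close>

lemma two_generator_E_group_imp_comm_group:
  assumes E: "E_group G" and gen: "generator_group 2 G"
  shows "comm_group G"
proof (cases "finite (carrier G)")
  case False
  obtain S where "S \<subseteq> carrier G" "finite S" "card S \<le> 2" "generate G S = carrier G" "group G"
    using gen by (auto simp: generator_group_def)
  \<comment> \<open>Having at most two generators is a special case of at most three, so the
    infinite case is already settled.\<close>
  then have "generator_group 3 G" unfolding generator_group_def by (intro conjI exI[of _ S]) auto
  then show ?thesis using infinite_three_generator_E_group_imp_comm_group E False by blast
next
  case True
  interpret two_engel_group G using E by (rule E_group_imp_two_engel_group)
  obtain S where S: "S \<subseteq> carrier G" "finite S" "card S \<le> 2" "generate G S = carrier G"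
    using gen by (auto simp: generator_group_def)
  obtain xs where xs: "set xs = S" "length xs \<le> 2"
    using finite_distinct_list[OF S(2)] S(3) by (metis distinct_card)
  define ys where "ys = xs @ replicate (2 - length xs) \<one>\<^bsub>G\<^esub>"
  have "length ys = 2" "S \<subseteq> set ys" "set ys \<subseteq> carrier G"
    using xs S by (auto simp: ys_def)
  then obtain a b where gens: "S \<subseteq> {a, b}" "{a, b} \<subseteq> carrier G"
    by (auto simp: numeral_2_eq_2 length_Suc_conv)
  have carr: "a \<in> carrier G" "b \<in> carrier G" using gens by auto
  have gen: "generate G {a, b} = carrier G"
    using mono_generate[OF gens(1)] generate_incl[OF gens(2)] S(4) by simp
  interpret two_generated_class_two_group G a b "commutator a b"
  proof unfold_locales
    show "commutator a b \<otimes>\<^bsub>G\<^esub> a = a \<otimes>\<^bsub>G\<^esub> commutator a b"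
      "commutator a b \<otimes>\<^bsub>G\<^esub> b = b \<otimes>\<^bsub>G\<^esub> commutator a b"
      by (rule commutator_commute[OF carr])+
    show "a \<otimes>\<^bsub>G\<^esub> b = commutator a b \<otimes>\<^bsub>G\<^esub> (b \<otimes>\<^bsub>G\<^esub> a)" by (rule mult_eq_commutator[OF carr])
  qed (use carr gen in auto)
  have "commutator a b = \<one>\<^bsub>G\<^esub>" using E_group_finite_imp_trivial_commutator[OF E True] .
  then have "a \<otimes>\<^bsub>G\<^esub> b = b \<otimes>\<^bsub>G\<^esub> a" using carr by (simp add: commutator_eq_one_iff)
  then have "s \<otimes>\<^bsub>G\<^esub> t = t \<otimes>\<^bsub>G\<^esub> s" if "s \<in> {a, b}" "t \<in> {a, b}" for s t
    using that by auto
  from generate_commute[OF gens(2) gens(2) this]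
  have "x \<otimes>\<^bsub>G\<^esub> y = y \<otimes>\<^bsub>G\<^esub> x" if "x \<in> carrier G" "y \<in> carrier G" for x y
    using that gen by blast
  then show ?thesis by (intro group_comm_groupI)
qed

lemma comm_group_imp_E_group:
  assumes "comm_group G"
  shows "E_group G"
proof -
  interpret comm_group G by fact
  have "x \<otimes>\<^bsub>G\<^esub> \<alpha> x = \<alpha> x \<otimes>\<^bsub>G\<^esub> x" if "x \<in> carrier G" "\<alpha> \<in> hom G G" for x \<alpha>
    using that by (intro m_comm) (auto dest: hom_in_carrier)
  then show ?thesis by (simp add: E_group_def is_group)
qed

theorem theorem1p3:
  fixes G :: "('a, 'b) monoid_scheme"
  shows "(generator_group 2 G \<longrightarrow> (comm_group G \<longleftrightarrow> E_group G)) \<and>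
         (generator_group 3 G \<and> infinite (carrier G) \<longrightarrow> (comm_group G \<longleftrightarrow> E_group G))"
  using comm_group_imp_E_group two_generator_E_group_imp_comm_group
    infinite_three_generator_E_group_imp_comm_group by blast

end
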